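(* Let $\mathcal M\subset\mathbb R^n$ be a compact embedded Riemannian submanifold, $f:\mathbb R^n\to\mathbb R$ a continuously differentiable, not necessarily convex, function whose gradient is $\ell_{\nabla f}$-Lipschitz, $\mathcal A:\mathbb R^n\to\mathbb R^m$ linear, $h$ convex and $\ell_h$-Lipschitz continuous on $\mathbb R^m$, and suppose $\varphi(x)=f(x)+h(\mathcal Ax)$ is bounded from below. Consider the problem $\min_{x\in\mathcal M} f(x)+h(\mathcal A x)$ and the algorithm ManIAL (described in the context), with the Riemannian gradient descent method RGD used as the subroutine for its subproblems. Then: (a) If $\sigma_k=b^k$ for some $b>1$ and $\epsilon_k=1/\sigma_k$, then ManIAL with Option I finds an $\epsilon$-KKT point after at most $\tilde{\mathcal O}(\epsilon^{-3})$ calls to the first-order oracle. (b) If $\sigma_k=2^{k/3}$, then ManIAL with Option II finds an $\epsilon$-KKT point after at most $\mathcal O(\epsilon^{-3})$ calls to the first-order oracle.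
   Context: Here $\mathcal O$ and $\tilde{\mathcal O}$ are as $\epsilon\to0$, with constants depending on the problem data and algorithm parameters but not on $\epsilon$; $\tilde{\mathcal O}$ additionally hides factors logarithmic in $1/\epsilon$. First-order oracle: one call consists of computing the Euclidean gradient $\nabla f(x)$, the proximal operator of (a multiple of) $h$, and the retraction $\mathcal R$. $\epsilon$-KKT point: $(x,y,z)\in\mathcal M\times\mathbb R^m\times\mathbb R^m$ with $\|\mathcal P_{T_x\mathcal M}(\nabla f(x)-\mathcal A^*z)\|\le\epsilon$, $\mathrm{dist}(-z,\partial h(y))\le\epsilon$, $\|\mathcal Ax-y\|\le\epsilon$. Here $\mathcal P_{T_x\mathcal M}$ is the orthogonal projection onto the tangent space. The point found is of the form $(x^{k+1},y^{k+1},\bar z^{k+1})$ with $\bar z^{k+1}:=z^k-\sigma_k(\mathcal Ax^{k+1}-y^{k+1})$. Moreau envelope and prox: $M_h^\mu(y)=\min_z\{h(z)+\frac1{2\mu}\|z-y\|^2\}$, with minimizer $\mathrm{prox}_{\mu h}(y)$. Augmented Lagrangian: $\mathcal L_\sigma(x,z)=f(x)+M_h^{1/\sigma}(\mathcal Ax-z/\sigma)-\frac1{2\sigma}\|z\|^2$. Write $\psi_k(x)=\mathcal L_{\sigma_k}(x,z^k)$ and $\psi_{k,\min}=\inf_{\mathcal M}\psi_k$. $\mathrm{grad}\,\psi(x)=\mathcal P_{T_x\mathcal M}(\nabla\psi(x))$ is the Riemannian gradient. Retraction: $\mathcal R:T\mathcal M\to\mathcal M$ is a smooth map with $\mathcal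 R_x(0)=x$ and $d\mathcal R_x(0)=\mathrm{id}$. The constants $\alpha,\beta>0$ are such that $\|\mathcal R_x(u)-x\|\le\alpha\|u\|$ and $\|\mathcal R_x(u)-x-u\|\le\beta\|u\|^2$ for all $x\in\mathcal M$, $u\in T_x\mathcal M$. ManIAL: input $x^0\in\mathcal M$, $z^0=0$, $y^0=\mathcal Ax^0$, $\beta_0>0$, increasing positive $\{\sigma_k\}_k$, decreasing positive $\{\epsilon_k\}_k$. For $k=0,1,2,\dots$: (1) apply the subroutine to $\min_{x\in\mathcal M}\mathcal L_{\sigma_k}(x,z^k)$ and return $x^{k+1}$, where Option I requires $\|\mathrm{grad}\,\mathcal L_{\sigma_k}(x^{k+1},z^k)\|\le\epsilon_k$ (gradient in $x$), and Option II returns the output of the subroutine after the fixed number $2^k$ of inner iterations; (2) $y^{k+1}=\mathrm{prox}_{h/\sigma_k}(\mathcal Ax^{k+1}-z^k/\sigma_k)$; (3) $\beta_{k+1}=\beta_0\min\left(\frac{\|\mathcal Ax^0-y^0\|\log^22}{\|\mathcal Ax^{k+1}-y^{k+1}\|(k+1)^2\log(k+2)},1\right)$ (interpreted as $\beta_0$ if $\mathcal Ax^{k+1}=y^{k+1}$); (4) $z^{k+1}=z^k-\beta_{k+1}(\mathcal Ax^{k+1}-y^{k+1})$. RGD$(\psi,L,T,x_0)$: for $t=0,\dots,T$, $x_{t+1}=\mathcal R_{x_t}(-\frac1L\mathrm{grad}\,\psi(x_t))$; output $x_{t^*}$ with $t^*\in\arg\min_{0\le t\le T}\|\mathrm{grad}\,\psi(x_t)\|$.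 Subroutine calls: with $G$ a finite constant satisfying $\|\nabla\psi_k(x)\|\le G$ for all $x\in\mathcal M$ and all $k$, let $L_k=\alpha^2(\ell_{\nabla f}+\sigma_k\|\mathcal A\|^2)+2G\beta$. For Option I, $x^{k+1}=$ RGD$(\psi_k,L_k,T_k,x^k)$ with $T_k=\max\{1,\lceil 2L_k(\psi_k(x^k)-\psi_{k,\min})/\epsilon_k^2\rceil\}$; for Option II, $x^{k+1}=$ RGD$(\psi_k,L_k,2^k,x^k)$. *)

theory Defs
  imports "HOL-Analysis.Analysis" "HOL-Library.Landau_Symbols"
begin

section \<open>Smooth maps, embedded submanifolds, retractions\<close>

text \<open>Only meant for open sets \<open>S\<close>: there \<open>Ck_on k f S\<close> says that \<open>f\<close> is \<open>k\<close> times continuously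
  differentiable, via iterated directional derivatives.\<close>

fun Ck_on :: "nat \<Rightarrow> ('a::euclidean_space \<Rightarrow> 'b::euclidean_space) \<Rightarrow> 'a set \<Rightarrow> bool" where
  "Ck_on 0 f S \<longleftrightarrow> continuous_on S f"
| "Ck_on (Suc k) f S \<longleftrightarrow>
     (\<forall>x\<in>S. f differentiable (at x)) \<and> (\<forall>v. Ck_on k (\<lambda>x. frechet_derivative f (at x) v) S)"

definition smooth_on :: "('a::euclidean_space \<Rightarrow> 'b::euclidean_space) \<Rightarrow> 'a set \<Rightarrow> bool" where
  "smooth_on f S \<longleftrightarrow> (\<forall>k. Ck_on k f S)"

text \<open>Smoothness of a map on a submanifold \<open>S\<close> (any subset of a Euclidean space):
  local smooth extendability to the ambient space.\<close>

definition smooth_map_on :: "('a::euclidean_space \<Rightarrow> 'b::euclidean_space) \<Rightarrow> 'a set \<Rightarrow> bool" where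
  "smooth_map_on f S \<longleftrightarrow>
     (\<forall>p\<in>S. \<exists>U F. open U \<and> p \<in> U \<and> smooth_on F U \<and> (\<forall>q\<in>S \<inter> U. F q = f q))"

text \<open>Local slice condition: near each of its points, \<open>M\<close> is straightened by a diffeomorphism
  of open sets of the ambient space to a \<open>d\<close>-dimensional linear subspace.\<close>

definition embedded_submanifold :: "nat \<Rightarrow> 'a::euclidean_space set \<Rightarrow> bool" where
  "embedded_submanifold d M \<longleftrightarrow>
     (\<forall>x\<in>M. \<exists>(U :: 'a set) (V :: 'a set) \<phi> \<phi>' E. open U \<and> open V \<and> x \<in> U \<and>
        homeomorphism U V \<phi> \<phi>' \<and> smooth_on \<phi> U \<and> smooth_on \<phi>' V \<and>
        subspace E \<and> dim E = d \<and> \<phi> ` (M \<inter> U) = E \<inter> V)"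

definition tangent_space :: "'a::euclidean_space set \<Rightarrow> 'a \<Rightarrow> 'a set" where
  "tangent_space M x =
     {v. \<exists>\<gamma> \<delta>. \<delta> > 0 \<and> smooth_on \<gamma> {-\<delta><..<\<delta>} \<and> \<gamma> ` {-\<delta><..<\<delta>} \<subseteq> M \<and> \<gamma> 0 = x \<and>
           (\<gamma> has_vector_derivative v) (at 0)}"

definition tangent_bundle :: "'a::euclidean_space set \<Rightarrow> ('a \<times> 'a) set" where
  "tangent_bundle M = Sigma M (tangent_space M)"

text \<open>\<open>R x u\<close> is \<open>\<R>\<^sub>x(u)\<close>; its values are only relevant for \<open>(x, u)\<close> in the tangent bundle.\<close>

definition manifold_retraction :: "'a::euclidean_space set \<Rightarrow> ('a \<Rightarrow> 'a \<Rightarrow> 'a) \<Rightarrow> bool" where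
  "manifold_retraction M R \<longleftrightarrow>
     (\<forall>x\<in>M. \<forall>u\<in>tangent_space M x. R x u \<in> M) \<and>
     smooth_map_on (\<lambda>(x, u). R x u) (tangent_bundle M) \<and>
     (\<forall>x\<in>M. R x 0 = x \<and> (R x has_derivative (\<lambda>u. u)) (at 0 within tangent_space M x))"

definition orth_proj :: "'a::euclidean_space set \<Rightarrow> 'a \<Rightarrow> 'a" where
  "orth_proj T u = (THE p. p \<in> T \<and> (\<forall>v\<in>T. orthogonal (u - p) v))"

definition gradient :: "('a::euclidean_space \<Rightarrow> real) \<Rightarrow> 'a \<Rightarrow> 'a" where
  "gradient f x = (THE g. GDERIV f x :> g)"

text \<open>Riemannian gradient for the metric induced from the ambient Euclidean space.\<close>

definition rgrad :: "'a::euclidean_space set \<Rightarrow> ('a \<Rightarrow> real) \<Rightarrow> 'a \<Rightarrow> 'a" where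
  "rgrad M \<psi> x = orth_proj (tangent_space M x) (gradient \<psi> x)"


section \<open>Convex analysis, augmented Lagrangian, KKT points\<close>

definition moreau :: "('b::euclidean_space \<Rightarrow> real) \<Rightarrow> real \<Rightarrow> 'b \<Rightarrow> real" where
  "moreau h \<mu> y = (INF z. h z + 1 / (2 * \<mu>) * (norm (z - y))\<^sup>2)"

text \<open>\<open>prox h \<mu>\<close> is the proximal operator of \<open>\<mu> h\<close>.\<close>

definition prox :: "('b::euclidean_space \<Rightarrow> real) \<Rightarrow> real \<Rightarrow> 'b \<Rightarrow> 'b" where
  "prox h \<mu> y = (ARG_MIN (\<lambda>z. h z + 1 / (2 * \<mu>) * (norm (z - y))\<^sup>2) z. True)"

definition subdifferential :: "('b::euclidean_space \<Rightarrow> real) \<Rightarrow> 'b \<Rightarrow> 'b set" where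
  "subdifferential h y = {g. \<forall>w. h w \<ge> h y + g \<bullet> (w - y)}"

definition aug_lagrangian ::
  "('a::euclidean_space \<Rightarrow> real) \<Rightarrow> ('b::euclidean_space \<Rightarrow> real) \<Rightarrow> ('a \<Rightarrow> 'b) \<Rightarrow>
   real \<Rightarrow> 'a \<Rightarrow> 'b \<Rightarrow> real" where
  "aug_lagrangian f h A \<sigma> x z =
     f x + moreau h (1 / \<sigma>) (A x - (1 / \<sigma>) *\<^sub>R z) - 1 / (2 * \<sigma>) * (norm z)\<^sup>2"

text \<open>The nonemptiness conjunct encodes that the distance to the empty set is infinite,
  whereas \<open>infdist\<close> is \<open>0\<close> there.\<close>

definition eps_KKT ::
  "'a::euclidean_space set \<Rightarrow> ('a \<Rightarrow> real) \<Rightarrow> ('b::euclidean_space \<Rightarrow> real) \<Rightarrow> ('a \<Rightarrow> 'b) \<Rightarrow>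
   real \<Rightarrow> 'a \<Rightarrow> 'b \<Rightarrow> 'b \<Rightarrow> bool" where
  "eps_KKT M f h A \<epsilon> x y z \<longleftrightarrow>
     x \<in> M \<and>
     norm (orth_proj (tangent_space M x) (gradient f x - adjoint A z)) \<le> \<epsilon> \<and>
     subdifferential h y \<noteq> {} \<and> infdist (- z) (subdifferential h y) \<le> \<epsilon> \<and>
     norm (A x - y) \<le> \<epsilon>"


section \<open>The algorithms\<close>

primrec rgd_iter ::
  "'a::euclidean_space set \<Rightarrow> ('a \<Rightarrow> 'a \<Rightarrow> 'a) \<Rightarrow> ('a \<Rightarrow> real) \<Rightarrow> real \<Rightarrow> 'a \<Rightarrow> nat \<Rightarrow> 'a" where
  "rgd_iter M R \<psi> L x0 0 = x0"
| "rgd_iter M R \<psi> L x0 (Suc t) =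
     (let x = rgd_iter M R \<psi> L x0 t in R x (- ((1 / L) *\<^sub>R rgrad M \<psi> x)))"

text \<open>The possible outputs of \<open>RGD(\<psi>, L, T, x0)\<close>: the minimizing index need not be unique,
  and no tie-breaking rule is imposed.\<close>

definition rgd_outputs ::
  "'a::euclidean_space set \<Rightarrow> ('a \<Rightarrow> 'a \<Rightarrow> 'a) \<Rightarrow> ('a \<Rightarrow> real) \<Rightarrow> real \<Rightarrow> nat \<Rightarrow> 'a \<Rightarrow> 'a set" where
  "rgd_outputs M R \<psi> L T x0 =
     {rgd_iter M R \<psi> L x0 t | t.
        is_arg_min (\<lambda>s. norm (rgrad M \<psi> (rgd_iter M R \<psi> L x0 s))) (\<lambda>s. s \<le> T) t}"

definition rgd_const ::
  "('a::euclidean_space \<Rightarrow> 'b::euclidean_space) \<Rightarrow> real \<Rightarrow> real \<Rightarrow> real \<Rightarrow> real \<Rightarrow> real \<Rightarrow> real" where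
  "rgd_const A \<alpha> \<beta> l\<^sub>f G \<sigma> = \<alpha>\<^sup>2 * (l\<^sub>f + \<sigma> * (onorm A)\<^sup>2) + 2 * G * \<beta>"

text \<open>Rules for the number of inner iterations, as functions of the outer index \<open>k\<close>, the
  subproblem objective \<open>\<psi>\<close> and the current point \<open>x\<close>.\<close>

definition budget_I ::
  "'a::euclidean_space set \<Rightarrow> (nat \<Rightarrow> real) \<Rightarrow> (nat \<Rightarrow> real) \<Rightarrow> nat \<Rightarrow> ('a \<Rightarrow> real) \<Rightarrow> 'a \<Rightarrow> nat" where
  "budget_I M L eps k \<psi> x = max 1 (nat \<lceil>2 * L k * (\<psi> x - (INF w\<in>M. \<psi> w)) / (eps k)\<^sup>2\<rceil>)"

definition budget_II :: "nat \<Rightarrow> ('a::euclidean_space \<Rightarrow> real) \<Rightarrow> 'a \<Rightarrow> nat" where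
  "budget_II k \<psi> x = 2 ^ k"

text \<open>\<open>manial_run\<close>: the sequences \<open>x\<close>, \<open>y\<close>, \<open>z\<close> and dual step sizes \<open>s\<close> (\<open>s k\<close> is \<open>\<beta>\<^sub>k\<close>) form a
  run of ManIAL with penalties \<open>\<sigma>\<close>, subroutine RGD with constants \<open>L\<close> and iteration
  numbers given by the rule \<open>T\<close>.\<close>

definition manial_run ::
  "'a::euclidean_space set \<Rightarrow> ('a \<Rightarrow> real) \<Rightarrow> ('b::euclidean_space \<Rightarrow> real) \<Rightarrow> ('a \<Rightarrow> 'b) \<Rightarrow>
   ('a \<Rightarrow> 'a \<Rightarrow> 'a) \<Rightarrow> 'a \<Rightarrow> real \<Rightarrow> (nat \<Rightarrow> real) \<Rightarrow> (nat \<Rightarrow> real) \<Rightarrow>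
   (nat \<Rightarrow> ('a \<Rightarrow> real) \<Rightarrow> 'a \<Rightarrow> nat) \<Rightarrow>
   (nat \<Rightarrow> 'a) \<Rightarrow> (nat \<Rightarrow> 'b) \<Rightarrow> (nat \<Rightarrow> 'b) \<Rightarrow> (nat \<Rightarrow> real) \<Rightarrow> bool" where
  "manial_run M f h A R x0 \<beta>0 \<sigma> L T x y z s \<longleftrightarrow>
     x 0 = x0 \<and> y 0 = A x0 \<and> z 0 = 0 \<and> s 0 = \<beta>0 \<and>
     (\<forall>k. let \<psi> = (\<lambda>w. aug_lagrangian f h A (\<sigma> k) w (z k));
              r = norm (A (x (Suc k)) - y (Suc k))
          in x (Suc k) \<in> rgd_outputs M R \<psi> (L k) (T k \<psi> (x k)) (x k) \<and>
             y (Suc k) = prox h (1 / \<sigma> k) (A (x (Suc k)) - (1 / \<sigma> k) *\<^sub>R z k) \<and>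
             s (Suc k) =
               (if r = 0 then \<beta>0
                else \<beta>0 * min (norm (A (x 0) - y 0) * (ln 2)\<^sup>2 /
                                (r * (real k + 1)\<^sup>2 * ln (real k + 2))) 1) \<and>
             z (Suc k) = z k - s (Suc k) *\<^sub>R (A (x (Suc k)) - y (Suc k)))"

text \<open>First-order oracle calls made in the outer iterations \<open>0, \<dots>, K\<close>: one for each of the
  \<open>T\<^sub>k + 1\<close> RGD steps \<open>t = 0, \<dots>, T\<^sub>k\<close>, and one for the proximal step that defines \<open>y (Suc k)\<close>.\<close>

definition oracle_calls ::
  "('a::euclidean_space \<Rightarrow> real) \<Rightarrow> ('b::euclidean_space \<Rightarrow> real) \<Rightarrow> ('a \<Rightarrow> 'b) \<Rightarrow> (nat \<Rightarrow> real) \<Rightarrow>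
   (nat \<Rightarrow> ('a \<Rightarrow> real) \<Rightarrow> 'a \<Rightarrow> nat) \<Rightarrow> (nat \<Rightarrow> 'a) \<Rightarrow> (nat \<Rightarrow> 'b) \<Rightarrow> nat \<Rightarrow> nat" where
  "oracle_calls f h A \<sigma> T x z K =
     (\<Sum>k\<le>K. (T k (\<lambda>w. aug_lagrangian f h A (\<sigma> k) w (z k)) (x k) + 1) + 1)"

text \<open>The outer iteration \<open>K\<close> produces an \<open>\<epsilon>\<close>-KKT point, with third component
  \<open>z\<^sup>K - \<sigma>\<^sub>K (A x\<^sup>K\<^sup>+\<^sup>1 - y\<^sup>K\<^sup>+\<^sup>1)\<close>.\<close>

definition KKT_found_at ::
  "'a::euclidean_space set \<Rightarrow> ('a \<Rightarrow> real) \<Rightarrow> ('b::euclidean_space \<Rightarrow> real) \<Rightarrow> ('a \<Rightarrow> 'b) \<Rightarrow>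
   (nat \<Rightarrow> real) \<Rightarrow> real \<Rightarrow> (nat \<Rightarrow> 'a) \<Rightarrow> (nat \<Rightarrow> 'b) \<Rightarrow> (nat \<Rightarrow> 'b) \<Rightarrow> nat \<Rightarrow> bool" where
  "KKT_found_at M f h A \<sigma> \<epsilon> x y z K \<longleftrightarrow>
     eps_KKT M f h A \<epsilon> (x (Suc K)) (y (Suc K))
       (z K - \<sigma> K *\<^sub>R (A (x (Suc K)) - y (Suc K)))"

definition soft_bigo :: "(real \<Rightarrow> real) \<Rightarrow> (real \<Rightarrow> real) \<Rightarrow> bool" where
  "soft_bigo N g \<longleftrightarrow> (\<exists>p::nat. N \<in> O[at_right 0](\<lambda>\<epsilon>. g \<epsilon> * ln (1 / \<epsilon>) ^ p))"

end

theory Submission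
  imports Defs
begin

text \<open>
  An outer iteration with penalty \<open>\<sigma>\<close> ends at a point \<open>x\<close>. Put \<open>y = prox\<^bsub>h/\<sigma>\<^esub> (A x - z/\<sigma>)\<close> and
  \<open>z' = z - \<sigma> (A x - y)\<close>. Optimality of the proximal point says exactly \<open>- z' \<in> \<partial>h(y)\<close>, and the
  gradient of the augmented Lagrangian at \<open>x\<close> is \<open>\<nabla>f(x) - A\<^sup>* z'\<close>. So two of the three KKT conditions
  are about quantities that the algorithm controls directly: the dual condition holds exactly, and
  the stationarity residual is the Riemannian gradient norm that the subroutine makes small. The
  third one, \<open>\<parallel>A x - y\<parallel> \<le> \<epsilon>\<close>, comes from the Lipschitz constant of \<open>h\<close>, which bounds all of its
  subgradients: \<open>\<sigma> (A x - y) = z - z'\<close>. The multipliers \<open>z\<close> stay at \<open>0\<close>, because \<open>y\<^sup>0 = A x\<^sup>0\<close> makes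
  the numerator in the dual step size vanish (\<open>manial_dual_zero\<close>), and therefore the residual is at
  most \<open>l\<^sub>h/\<sigma>\<close>.

  Each subproblem objective \<open>\<psi>\<close> has a quadratic upper bound with curvature
  \<open>l\<^sub>f + \<sigma> \<parallel>A\<parallel>\<^sup>2\<close> (\<open>aug_lagrangian_upper_bound\<close>), since the Moreau envelope is squeezed between its
  tangent plane and that plane plus a quadratic. Together with the two retraction estimates this
  turns a step of length \<open>1/L\<close> along the negative Riemannian gradient into a decrease of
  \<open>\<parallel>grad \<psi>\<parallel>\<^sup>2/(2L)\<close>, and telescoping gives \<open>(T + 1) min \<parallel>grad \<psi>\<parallel>\<^sup>2 \<le> 2 L (\<psi>(x) - inf \<psi>)\<close>
  (\<open>rgd_rate\<close>). The projection behind the Riemannian gradient and the tangency of the steps rest on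
  the fact that the velocities of curves in \<open>M\<close> form a linear subspace, which is proved from a slice
  chart (\<open>subspace_tangent_space\<close>).

  On the compact set \<open>M\<close> the gap \<open>\<psi>(x) - inf \<psi>\<close> is bounded uniformly in \<open>\<sigma> \<ge> 1\<close>
  (\<open>aug_lagrangian_gap\<close>), and \<open>L\<close> grows linearly in \<open>\<sigma>\<close>. With accuracy \<open>1/\<sigma>\<^sub>k\<close>, iteration \<open>k\<close> of
  Option I hence costs \<open>O(\<sigma>\<^sub>k\<^sup>3)\<close> calls. With \<open>\<sigma>\<^sub>k = 2\<^bsup>k/3\<^esup>\<close>, the \<open>2\<^sup>k = \<sigma>\<^sub>k\<^sup>3\<close> steps of Option II reach a
  gradient norm \<open>O(1/\<sigma>\<^sub>k)\<close>. In both cases \<open>\<sigma>\<^sub>k = b\<^sup>k\<close> for some \<open>b > 1\<close>, a KKT point with tolerance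
  \<open>c/\<sigma>\<^sub>k\<close> is found in iteration \<open>k\<close>, and the cost up to iteration \<open>K\<close> is a geometric sum of order
  \<open>\<sigma>\<^sub>K\<^sup>3\<close>. The first \<open>K\<close> with \<open>c/\<sigma>\<^sub>K \<le> \<epsilon>\<close> has \<open>\<sigma>\<^sub>K = O(1/\<epsilon>)\<close>, which gives \<open>O(\<epsilon>\<^sup>-\<^sup>3)\<close> calls
  (\<open>manial_complexity\<close>), for Option I even with no logarithmic factor.
\<close>

section \<open>Tangent spaces and orthogonal projections\<close>

text \<open>Iterated derivatives only see germs, so on an open set smoothness passes to every function that
  agrees there. It lets the derivative of a composition be replaced by its chain-rule formula.\<close>

lemma Ck_on_cong:
  assumes "open S" "\<And>x. x \<in> S \<Longrightarrow> f x = g x" "Ck_on k f S"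
  shows "Ck_on k g S"
  using assms(2,3)
proof (induction k arbitrary: f g)
  case 0
  then show ?case using continuous_on_cong[of S S f g] by simp
next
  case (Suc k)
  have der: "(g has_derivative frechet_derivative f (at x)) (at x)" if "x \<in> S" for x
  proof -
    have "(f has_derivative frechet_derivative f (at x)) (at x)"
      using Suc.prems(2) that frechet_derivative_works by auto
    then show ?thesis
      using has_derivative_transform_within_open[OF _ \<open>open S\<close> that] Suc.prems(1) by blast
  qed
  have "Ck_on k (\<lambda>x. frechet_derivative g (at x) v) S" for v
  proof (rule Suc.IH)
    show "frechet_derivative f (at x) v = frechet_derivative g (at x) v" if "x \<in> S" for x
      using frechet_derivative_at[OF der[OF that]] by simp
    show "Ck_on k (\<lambda>x. frechet_derivative f (at x) v) S"
      using Suc.prems(2) by simp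
  qed
  moreover have "\<forall>x\<in>S. g differentiable (at x)"
    using der differentiableI by blast
  ultimately show ?case by simp
qed

text \<open>A directional derivative of \<open>F\<close> restricted to a line is the restriction to the line of a
  directional derivative of \<open>F\<close>, so the induction never leaves this shape. This special case of
  smoothness of compositions suffices to produce smooth curves in a submanifold.\<close>

lemma Ck_on_line:
  fixes p v :: "'a::euclidean_space"
  assumes "open S" "\<And>t::real. t \<in> S \<Longrightarrow> p + t *\<^sub>R v \<in> V" "Ck_on k F V"
  shows "Ck_on k (\<lambda>t. F (p + t *\<^sub>R v)) S"
  using assms(3)
proof (induction k arbitrary: F)
  case 0
  then have "continuous_on V F" by simp
  then have "continuous_on S (\<lambda>t. F (p + t *\<^sub>R v))"
    by (rule continuous_on_compose2) (use assms(2) in \<open>auto intro!: continuous_intros\<close>)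
  then show ?case by simp
next
  case (Suc k)
  have der: "((\<lambda>t. F (p + t *\<^sub>R v)) has_derivative
      (\<lambda>r. frechet_derivative F (at (p + t *\<^sub>R v)) (r *\<^sub>R v))) (at t)" if "t \<in> S" for t
  proof -
    have "(F has_derivative frechet_derivative F (at (p + t *\<^sub>R v))) (at (p + t *\<^sub>R v))"
      using Suc.prems assms(2)[OF that] frechet_derivative_works by auto
    moreover have "((\<lambda>t. p + t *\<^sub>R v) has_derivative (\<lambda>r. r *\<^sub>R v)) (at t)"
      by (auto intro!: derivative_eq_intros)
    ultimately show ?thesis
      using has_derivative_compose by blast
  qed
  have "Ck_on k (\<lambda>t. frechet_derivative (\<lambda>t. F (p + t *\<^sub>R v)) (at t) r) S" for r
  proof (rule Ck_on_cong[OF \<open>open S\<close>])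
    show "Ck_on k (\<lambda>t. frechet_derivative F (at (p + t *\<^sub>R v)) (r *\<^sub>R v)) S"
      using Suc.IH[of "\<lambda>q. frechet_derivative F (at q) (r *\<^sub>R v)"] Suc.prems by simp
    show "frechet_derivative F (at (p + t *\<^sub>R v)) (r *\<^sub>R v)
        = frechet_derivative (\<lambda>t. F (p + t *\<^sub>R v)) (at t) r" if "t \<in> S" for t
      using fun_cong[OF frechet_derivative_at[OF der[OF that]], of r] by simp
  qed
  moreover have "\<forall>t\<in>S. (\<lambda>t. F (p + t *\<^sub>R v)) differentiable (at t)"
    using der differentiableI by blast
  ultimately show ?case by simp
qed

lemma smooth_on_has_derivative:
  assumes "smooth_on f S" "x \<in> S"
  shows "(f has_derivative frechet_derivative f (at x)) (at x)"
proof -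
  have "Ck_on (Suc 0) f S" using assms(1) unfolding smooth_on_def by blast
  then show ?thesis using assms(2) frechet_derivative_works by auto
qed

lemma orth_proj:
  assumes "subspace T"
  shows "orth_proj T u \<in> T" "v \<in> T \<Longrightarrow> (u - orth_proj T u) \<bullet> v = 0"
proof -
  obtain p q where pq: "p \<in> span T" "\<And>w. w \<in> span T \<Longrightarrow> orthogonal q w" "u = p + q"
    using orthogonal_subspace_decomp_exists[of T u] by blast
  have "span T = T" using assms by (simp add: span_eq_iff)
  then have p: "p \<in> T \<and> (\<forall>v\<in>T. orthogonal (u - p) v)"
    using pq unfolding \<open>span T = T\<close> by simp
  moreover have "p' = p" if p': "p' \<in> T \<and> (\<forall>v\<in>T. orthogonal (u - p') v)" for p'
  proof -
    have "p - p' \<in> T" using p p' assms by (simp add: subspace_diff)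
    then have "(u - p') \<bullet> (p - p') - (u - p) \<bullet> (p - p') = 0"
      using p p' by (simp add: orthogonal_def)
    then have "(p - p') \<bullet> (p - p') = 0" by (simp add: inner_diff_left)
    then show ?thesis by simp
  qed
  ultimately have "orth_proj T u = p"
    unfolding orth_proj_def by (rule the_equality)
  then show "orth_proj T u \<in> T" "v \<in> T \<Longrightarrow> (u - orth_proj T u) \<bullet> v = 0"
    using p by (auto simp: orthogonal_def)
qed

text \<open>The component of \<open>c\<close> along the part of \<open>w\<close> orthogonal to \<open>E\<close> is constantly \<open>0\<close> near the base point,
  so its derivative, the squared norm of that part, vanishes.\<close>

lemma vector_derivative_in_subspace:
  fixes c :: "real \<Rightarrow> 'a::euclidean_space"
  assumes "subspace E" "(c has_vector_derivative w) (at 0)" "eventually (\<lambda>t. c t \<in> E) (at 0)" "c 0 \<in> E"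
  shows "w \<in> E"
proof -
  define q where "q = w - orth_proj E w"
  have perp: "q \<bullet> v = 0" if "v \<in> E" for v
    using orth_proj(2)[OF assms(1) that] unfolding q_def .
  have "((\<lambda>t. c t \<bullet> q) has_derivative (\<lambda>r. (r *\<^sub>R w) \<bullet> q)) (at 0)"
    by (rule has_derivative_inner_left[OF assms(2)[unfolded has_vector_derivative_def]])
  moreover have "eventually (\<lambda>t. c t \<bullet> q = 0) (at 0)"
    using assms(3) by eventually_elim (metis perp inner_commute)
  ultimately have "((\<lambda>t. 0) has_derivative (\<lambda>r. (r *\<^sub>R w) \<bullet> q)) (at (0::real))"
    by (rule has_derivative_transform_eventually) (use perp[OF assms(4)] in \<open>auto simp: inner_commute\<close>)
  then have "(\<lambda>r. (r *\<^sub>R w) \<bullet> q) = (\<lambda>r::real. 0)"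
    by (rule has_derivative_unique) (rule has_derivative_const)
  from fun_cong[OF this, of 1] have "w \<bullet> q = 0" by simp
  moreover have "orth_proj E w \<bullet> q = 0"
    using perp[OF orth_proj(1)[OF assms(1)]] by (simp add: inner_commute)
  ultimately have "q \<bullet> q = 0" unfolding q_def by (simp add: inner_diff_left)
  then show ?thesis using orth_proj(1)[OF assms(1), of w] unfolding q_def by simp
qed

text \<open>In a slice chart \<open>\<phi>\<close> a curve in \<open>M\<close> becomes a curve in the linear subspace \<open>E\<close>, whose velocity lies
  in \<open>E\<close>; conversely, straight lines in \<open>E\<close> pull back to smooth curves in \<open>M\<close>. Hence the tangent
  space is the image of \<open>E\<close> under the derivative of the inverse chart. This is what makes the
  orthogonal projection, and with it the Riemannian gradient, well defined.\<close>

lemma subspace_tangent_space: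
  fixes M :: "'a::euclidean_space set"
  assumes "embedded_submanifold d M" "x \<in> M"
  shows "subspace (tangent_space M x)"
proof -
  obtain U V :: "'a set" and \<phi> \<phi>' E where
    UV: "open U" "open V" "x \<in> U" and hom: "homeomorphism U V \<phi> \<phi>'"
    and sm: "smooth_on \<phi> U" "smooth_on \<phi>' V" and E: "subspace E"
    and slice: "\<phi> ` (M \<inter> U) = E \<inter> V"
    using assms(1)[unfolded embedded_submanifold_def, rule_format, OF assms(2)]
    by (elim exE conjE) (rule that; assumption)
  have inv: "\<phi>' (\<phi> q) = q" if "q \<in> U" for q
    using hom that by (simp add: homeomorphism_def)
  have \<phi>xV: "\<phi> x \<in> V" and \<phi>xE: "\<phi> x \<in> E"
    using slice assms(2) UV(3) by auto
  define D where "D = frechet_derivative \<phi> (at x)"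
  define D' where "D' = frechet_derivative \<phi>' (at (\<phi> x))"
  have D: "(\<phi> has_derivative D) (at x)"
    unfolding D_def by (rule smooth_on_has_derivative[OF sm(1) UV(3)])
  have D': "(\<phi>' has_derivative D') (at (\<phi> x))"
    unfolding D'_def by (rule smooth_on_has_derivative[OF sm(2) \<phi>xV])
  have "((\<lambda>q. \<phi>' (\<phi> q)) has_derivative (\<lambda>v. D' (D v))) (at x)"
    by (rule has_derivative_compose[OF D D'])
  then have "((\<lambda>q. q) has_derivative (\<lambda>v. D' (D v))) (at x)"
    by (rule has_derivative_transform_within_open[OF _ UV(1,3)]) (simp add: inv)
  then have D'D: "D' (D v) = v" for v
    using fun_cong[OF has_derivative_unique[OF _ has_derivative_ident]] by blast
  have "tangent_space M x = D' ` E"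
  proof (intro equalityI subsetI)
    fix v assume "v \<in> tangent_space M x"
    then obtain \<gamma> \<delta> where \<delta>: "\<delta> > 0" and \<gamma>M: "\<gamma> ` {-\<delta><..<\<delta>} \<subseteq> M" and \<gamma>0: "\<gamma> 0 = x"
      and \<gamma>v: "(\<gamma> has_vector_derivative v) (at 0)"
      unfolding tangent_space_def by blast
    have "((\<lambda>t. \<phi> (\<gamma> t)) has_derivative (\<lambda>r. D (r *\<^sub>R v))) (at 0)"
      using has_derivative_compose[OF \<gamma>v[unfolded has_vector_derivative_def]] D \<gamma>0 by simp
    then have der: "((\<lambda>t. \<phi> (\<gamma> t)) has_vector_derivative D v) (at 0)"
      unfolding has_vector_derivative_def
      by (simp add: linear_cmul[OF has_derivative_linear[OF D]])
    have "isCont \<gamma> 0"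
      using \<gamma>v has_vector_derivative_continuous by blast
    then have "eventually (\<lambda>t. \<gamma> t \<in> U) (at 0)"
      using UV(1,3) \<gamma>0 unfolding isCont_def by (auto dest: topological_tendstoD)
    moreover have "eventually (\<lambda>t. t \<in> {-\<delta><..<\<delta>}) (at (0::real))"
      by (rule eventually_at_in_open') (use \<delta> in auto)
    ultimately have "eventually (\<lambda>t. \<phi> (\<gamma> t) \<in> E) (at 0)"
      by eventually_elim (use \<gamma>M slice in blast)
    then have "D v \<in> E"
      using vector_derivative_in_subspace[OF E der] \<phi>xE \<gamma>0 by simp
    then show "v \<in> D' ` E" using D'D by (metis imageI)
  next
    fix v assume "v \<in> D' ` E"
    then obtain e where e: "e \<in> E" "v = D' e" by blast
    have "open ((\<lambda>t::real. \<phi> x + t *\<^sub>R e) -` V)"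
      by (rule open_vimage[OF UV(2)]) (auto intro!: continuous_intros)
    moreover have "0 \<in> (\<lambda>t::real. \<phi> x + t *\<^sub>R e) -` V" using \<phi>xV by simp
    ultimately obtain \<delta> where \<delta>: "\<delta> > 0" and ball: "ball 0 \<delta> \<subseteq> (\<lambda>t::real. \<phi> x + t *\<^sub>R e) -` V"
      by (rule openE)
    have inV: "\<phi> x + t *\<^sub>R e \<in> V" if "t \<in> {-\<delta><..<\<delta>}" for t
      using ball that by (auto simp: subset_iff dist_real_def)
    define \<gamma> where "\<gamma> t = \<phi>' (\<phi> x + t *\<^sub>R e)" for t
    have "smooth_on \<gamma> {-\<delta><..<\<delta>}"
      unfolding smooth_on_def \<gamma>_def
      using Ck_on_line[OF open_greaterThanLessThan inV] sm(2)[unfolded smooth_on_def] by blast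
    moreover have "\<gamma> ` {-\<delta><..<\<delta>} \<subseteq> M"
    proof
      fix q assume "q \<in> \<gamma> ` {-\<delta><..<\<delta>}"
      then obtain t where t: "t \<in> {-\<delta><..<\<delta>}" "q = \<gamma> t" by blast
      have "\<phi> x + t *\<^sub>R e \<in> E \<inter> V"
        using inV[OF t(1)] \<phi>xE e(1) E by (simp add: subspace_add subspace_mul)
      then have "\<phi> x + t *\<^sub>R e \<in> \<phi> ` (M \<inter> U)" using slice by simp
      then obtain q' where q': "q' \<in> M" "q' \<in> U" "\<phi> x + t *\<^sub>R e = \<phi> q'" by blast
      then show "q \<in> M" using t(2) inv[OF q'(2)] unfolding \<gamma>_def by simp
    qed
    moreover have "\<gamma> 0 = x" unfolding \<gamma>_def using inv UV(3) by simp
    moreover have "(\<gamma> has_vector_derivative v) (at 0)"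
    proof -
      have "((\<lambda>t. \<phi> x + t *\<^sub>R e) has_derivative (\<lambda>r. r *\<^sub>R e)) (at 0)"
        by (auto intro!: derivative_eq_intros)
      from has_derivative_compose[OF this] D'
      have "(\<gamma> has_derivative (\<lambda>r. D' (r *\<^sub>R e))) (at 0)"
        unfolding \<gamma>_def by simp
      then show ?thesis
        unfolding has_vector_derivative_def e(2)
        by (simp add: linear_cmul[OF has_derivative_linear[OF D']])
    qed
    ultimately show "v \<in> tangent_space M x"
      unfolding tangent_space_def using \<delta> by blast
  qed
  then show ?thesis
    using linear_subspace_image[OF has_derivative_linear[OF D'] E] by simp
qed

lemma norm_orth_proj_le:
  assumes "subspace T"
  shows "norm (orth_proj T u) \<le> norm u"
proof -
  define p where "p = orth_proj T u"
  have "(u - p) \<bullet> p = 0" using orth_proj[OF assms] unfolding p_def by blast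
  then have "norm p * norm p = u \<bullet> p"
    using power2_norm_eq_inner[of p] by (simp add: inner_diff_left power2_eq_square)
  also have "\<dots> \<le> norm u * norm p" by (rule norm_cauchy_schwarz)
  finally show ?thesis unfolding p_def[symmetric]
    by (cases "norm p = 0") (auto dest: mult_right_le_imp_le)
qed

section \<open>Gradients\<close>

lemma gradient_eq:
  assumes "GDERIV f x :> g"
  shows "gradient f x = g"
  unfolding gradient_def
proof (rule the_equality)
  show "GDERIV f x :> g" by (rule assms)
next
  fix g' assume "GDERIV f x :> g'"
  then have "(\<lambda>v. v \<bullet> g') = (\<lambda>v. v \<bullet> g)"
    using assms unfolding gderiv_def by (rule has_derivative_unique)
  then have "v \<bullet> g' = v \<bullet> g" for v by (rule fun_cong)
  then show "g' = g" using vector_eq_ldot[of g' g] by simp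
qed

lemma GDERIV_gradient:
  fixes f :: "'a::euclidean_space \<Rightarrow> real"
  assumes "f differentiable (at x)"
  shows "GDERIV f x :> gradient f x"
proof -
  obtain D where D: "(f has_derivative D) (at x)"
    using assms unfolding differentiable_def by blast
  have "D v = v \<bullet> adjoint D 1" for v
    using adjoint_works[OF has_derivative_linear[OF D], of v 1] by simp
  then have "D = (\<lambda>v. v \<bullet> adjoint D 1)" by blast
  then have "GDERIV f x :> adjoint D 1" using D unfolding gderiv_def by simp
  then show ?thesis using gradient_eq[of f x] by simp
qed

lemma GDERIV_of_quadratic_bound:
  fixes F :: "'a::real_inner \<Rightarrow> real"
  assumes "\<And>y. \<bar>F y - F x - g \<bullet> (y - x)\<bar> \<le> C * (norm (y - x))\<^sup>2"
  shows "GDERIV F x :> g"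
proof -
  have bound: "norm (norm (F (x + v) - F x - v \<bullet> g) / norm v) \<le> C * norm v" for v
  proof -
    have "norm (F (x + v) - F x - v \<bullet> g) \<le> (C * norm v) * norm v"
      using assms[of "x + v"] by (simp add: inner_commute power2_eq_square mult_ac)
    then show ?thesis
      by (cases "v = 0") (simp_all add: divide_le_eq)
  qed
  have "((\<lambda>v. norm (F (x + v) - F x - v \<bullet> g) / norm v) \<longlongrightarrow> 0) (at 0)"
    by (rule Lim_null_comparison[where g = "\<lambda>v. C * norm v"])
       (use bound in \<open>auto intro!: always_eventually tendsto_eq_intros\<close>)
  then show ?thesis
    unfolding gderiv_def has_derivative_at using bounded_linear_inner_left by blast
qed

text \<open>Along the segment from \<open>x\<close> to \<open>y\<close> the defect between \<open>f\<close> and its quadratic model has nonpositive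
  derivative, by Cauchy-Schwarz and the Lipschitz bound.\<close>

lemma lipschitz_gradient_upper_bound:
  fixes f :: "'a::euclidean_space \<Rightarrow> real"
  assumes diff: "\<And>x. f differentiable (at x)" and lip: "L-lipschitz_on UNIV (gradient f)"
  shows "f y \<le> f x + gradient f x \<bullet> (y - x) + L / 2 * (norm (y - x))\<^sup>2"
proof -
  define d where "d = y - x"
  define \<theta> where "\<theta> t = f (x + t *\<^sub>R d) - t * (gradient f x \<bullet> d) - L / 2 * t\<^sup>2 * (norm d)\<^sup>2" for t
  have der: "(\<theta> has_real_derivative
      gradient f (x + t *\<^sub>R d) \<bullet> d - gradient f x \<bullet> d - L * t * (norm d)\<^sup>2) (at t)" for t
  proof -
    have "((\<lambda>t. x + t *\<^sub>R d) has_derivative (\<lambda>r. r *\<^sub>R d)) (at t)"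
      by (auto intro!: derivative_eq_intros)
    from has_derivative_compose[OF this GDERIV_gradient[OF diff, unfolded gderiv_def]]
    have "((\<lambda>t. f (x + t *\<^sub>R d)) has_real_derivative gradient f (x + t *\<^sub>R d) \<bullet> d) (at t)"
      by (simp add: has_field_derivative_def inner_commute mult_commute_abs)
    then show ?thesis
      unfolding \<theta>_def by (auto intro!: derivative_eq_intros)
  qed
  have "\<theta> 1 \<le> \<theta> 0"
  proof (rule DERIV_nonpos_imp_nonincreasing[where f = \<theta>])
    fix t :: real assume t: "0 \<le> t" "t \<le> 1"
    have "(gradient f (x + t *\<^sub>R d) - gradient f x) \<bullet> d
        \<le> norm (gradient f (x + t *\<^sub>R d) - gradient f x) * norm d"
      by (rule norm_cauchy_schwarz)
    also have "\<dots> \<le> (L * (t * norm d)) * norm d"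
      using lipschitz_onD[OF lip, of "x + t *\<^sub>R d" x] t
      by (intro mult_right_mono) (auto simp: dist_norm)
    finally have "gradient f (x + t *\<^sub>R d) \<bullet> d - gradient f x \<bullet> d - L * t * (norm d)\<^sup>2 \<le> 0"
      by (simp add: inner_diff_left power2_eq_square mult_ac)
    then show "\<exists>y. (\<theta> has_real_derivative y) (at t) \<and> y \<le> 0" using der by blast
  qed simp
  then show ?thesis unfolding \<theta>_def d_def by simp
qed

section \<open>The proximal operator and the Moreau envelope\<close>

locale convex_lipschitz =
  fixes h :: "'b::euclidean_space \<Rightarrow> real" and l :: real
  assumes convex: "convex_on UNIV h" and lipschitz: "l-lipschitz_on UNIV h"
begin

lemma l_nonneg: "0 \<le> l" using lipschitz by (rule lipschitz_on_nonneg)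

lemma diff_le: "h y - h w \<le> l * norm (w - y)"
  using lipschitz_onD[OF lipschitz, of y w] by (simp add: dist_norm norm_minus_commute)

lemma continuous: "continuous_on S h"
  using lipschitz_on_continuous_on[OF lipschitz] continuous_on_subset by blast

text \<open>The objective is continuous, and by the Lipschitz bound on \<open>h\<close> its values outside the ball of
  radius \<open>2 \<mu> l\<close> around \<open>y\<close> are at least the value at \<open>y\<close>. So a minimizer over this compact ball is a
  global one, and the choice in the definition of the proximal operator is meaningful.\<close>

lemma prox_minimal:
  assumes "\<mu> > 0"
  shows "h (prox h \<mu> y) + 1 / (2 * \<mu>) * (norm (prox h \<mu> y - y))\<^sup>2
       \<le> h z + 1 / (2 * \<mu>) * (norm (z - y))\<^sup>2"
proof -
  let ?q = "\<lambda>z. h z + 1 / (2 * \<mu>) * (norm (z - y))\<^sup>2"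
  have "continuous_on (cball y (2 * \<mu> * l)) ?q"
    by (intro continuous_intros continuous)
  moreover have "y \<in> cball y (2 * \<mu> * l)" using l_nonneg assms by simp
  ultimately obtain p where p: "\<And>z. z \<in> cball y (2 * \<mu> * l) \<Longrightarrow> ?q p \<le> ?q z"
    using continuous_attains_inf[OF compact_cball] by blast
  have "?q p \<le> ?q z" for z
  proof (cases "z \<in> cball y (2 * \<mu> * l)")
    case False
    then have r: "2 * \<mu> * l \<le> norm (z - y)" by (simp add: dist_norm norm_minus_commute)
    have "l * norm (z - y) \<le> 1 / (2 * \<mu>) * (norm (z - y))\<^sup>2"
      using mult_right_mono[OF r norm_ge_zero[of "z - y"]] assms
      by (simp add: field_simps power2_eq_square)
    then have "?q y \<le> ?q z" using diff_le[of y z] by simp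
    then show ?thesis using p[OF \<open>y \<in> cball _ _\<close>] by linarith
  qed (rule p)
  then have "is_arg_min ?q (\<lambda>_. True) p" by (simp add: is_arg_min_linorder)
  then have "is_arg_min ?q (\<lambda>_. True) (prox h \<mu> y)"
    unfolding prox_def arg_min_def by (rule someI)
  then show ?thesis by (simp add: is_arg_min_linorder)
qed

lemma moreau_eq_prox:
  assumes "\<mu> > 0"
  shows "moreau h \<mu> y = h (prox h \<mu> y) + 1 / (2 * \<mu>) * (norm (prox h \<mu> y - y))\<^sup>2"
  unfolding moreau_def
  by (rule cInf_eq_minimum) (use prox_minimal[OF assms] in auto)

text \<open>The optimality condition of the proximal problem: compare the minimizer \<open>p\<close> with points
  \<open>p + t (w - p)\<close>, use convexity of \<open>h\<close>, divide by \<open>t\<close> and let \<open>t\<close> tend to \<open>0\<close>.\<close>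

lemma prox_subgradient:
  assumes "\<mu> > 0"
  shows "(1 / \<mu>) *\<^sub>R (y - prox h \<mu> y) \<in> subdifferential h (prox h \<mu> y)"
  unfolding subdifferential_def
proof (intro CollectI allI)
  fix w
  define p where "p = prox h \<mu> y"
  define c where "c = h w - h p - (1 / \<mu>) *\<^sub>R (y - p) \<bullet> (w - p)"
  have bound: "0 \<le> c + t * (1 / (2 * \<mu>) * (norm (w - p))\<^sup>2)" if t: "0 < t" "t < 1" for t
  proof -
    define m where "m = p + t *\<^sub>R (w - p)"
    have m: "m = (1 - t) *\<^sub>R p + t *\<^sub>R w" unfolding m_def by (simp add: algebra_simps)
    have hm: "h m \<le> (1 - t) * h p + t * h w"
      unfolding m using convex_onD[OF convex] t by simp
    have sq: "(norm (m - y))\<^sup>2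
        = (norm (p - y))\<^sup>2 - 2 * t * ((y - p) \<bullet> (w - p)) + t\<^sup>2 * (norm (w - p))\<^sup>2"
      unfolding m_def power2_norm_eq_inner
      by (simp add: algebra_simps inner_commute power2_eq_square)
    have "h p + 1 / (2 * \<mu>) * (norm (p - y))\<^sup>2 \<le> h m + 1 / (2 * \<mu>) * (norm (m - y))\<^sup>2"
      using prox_minimal[OF assms, of y m] unfolding p_def .
    with hm have "0 \<le> t * (h w - h p) + 1 / (2 * \<mu>) * (- 2 * t * ((y - p) \<bullet> (w - p)) + t\<^sup>2 * (norm (w - p))\<^sup>2)"
      unfolding sq by (simp add: algebra_simps)
    also have "\<dots> = t * (c + t * (1 / (2 * \<mu>) * (norm (w - p))\<^sup>2))"
      unfolding c_def inner_scaleR_left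
      using assms by (simp add: field_simps power2_eq_square)
    finally show ?thesis using t by (simp add: zero_le_mult_iff)
  qed
  have "((\<lambda>t. c + t * e) \<longlongrightarrow> c) (at_right 0)" for e
    by (auto intro!: tendsto_eq_intros)
  moreover have "eventually (\<lambda>t. 0 \<le> c + t * (1 / (2 * \<mu>) * (norm (w - p))\<^sup>2)) (at_right 0)"
    by (rule eventually_mono[OF eventually_at_right_real[of 0 1]]) (use bound in auto)
  ultimately have "0 \<le> c"
    by (rule tendsto_lowerbound) simp
  then show "h (prox h \<mu> y) + (1 / \<mu>) *\<^sub>R (y - prox h \<mu> y) \<bullet> (w - prox h \<mu> y) \<le> h w"
    unfolding c_def p_def by simp
qed

text \<open>Test the subgradient inequality at \<open>y + g\<close>.\<close>

lemma norm_subgradient_le: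
  assumes "g \<in> subdifferential h y"
  shows "norm g \<le> l"
proof -
  have "norm g * norm g \<le> h (y + g) - h y"
    using assms unfolding subdifferential_def
    by (auto dest!: spec[of _ "y + g"] simp flip: power2_norm_eq_inner power2_eq_square)
  also have "\<dots> \<le> l * norm g" using diff_le[of "y + g" y] by simp
  finally show ?thesis
    by (cases "norm g = 0") (use l_nonneg in \<open>auto dest: mult_right_le_imp_le\<close>)
qed

text \<open>Use the minimizer for \<open>y\<close> as a candidate in the problem for \<open>y'\<close>.\<close>

lemma moreau_upper:
  assumes "\<mu> > 0"
  shows "moreau h \<mu> y' \<le> moreau h \<mu> y + (1 / \<mu>) *\<^sub>R (y - prox h \<mu> y) \<bullet> (y' - y)
           + 1 / (2 * \<mu>) * (norm (y' - y))\<^sup>2"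
proof -
  define p where "p = prox h \<mu> y"
  have "moreau h \<mu> y' \<le> h p + 1 / (2 * \<mu>) * (norm (p - y'))\<^sup>2"
    unfolding moreau_eq_prox[OF assms] by (rule prox_minimal[OF assms])
  also have "(norm (p - y'))\<^sup>2 = (norm (p - y))\<^sup>2 + 2 * ((y - p) \<bullet> (y' - y)) + (norm (y' - y))\<^sup>2"
    unfolding power2_norm_eq_inner by (simp add: algebra_simps inner_commute)
  finally show ?thesis
    unfolding moreau_eq_prox[OF assms, of y] p_def[symmetric] inner_scaleR_left
    using assms by (simp add: field_simps)
qed

text \<open>Bound \<open>h\<close> at the minimizer for \<open>y'\<close> below by its subgradient inequality at the minimizer for \<open>y\<close>;
  what remains is a complete square. With the upper bound this gives differentiability and the
  curvature \<open>1/\<mu>\<close> at once.\<close>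

lemma moreau_lower:
  assumes "\<mu> > 0"
  shows "moreau h \<mu> y' \<ge> moreau h \<mu> y + (1 / \<mu>) *\<^sub>R (y - prox h \<mu> y) \<bullet> (y' - y)"
proof -
  define p where "p = prox h \<mu> y"
  define p' where "p' = prox h \<mu> y'"
  define g where "g = (1 / \<mu>) *\<^sub>R (y - p)"
  have y: "y = p + \<mu> *\<^sub>R g" unfolding g_def using assms by simp
  have "h p' \<ge> h p + g \<bullet> (p' - p)"
    using prox_subgradient[OF assms, of y] unfolding subdifferential_def g_def p_def by blast
  moreover have "moreau h \<mu> y' = h p' + 1 / (2 * \<mu>) * (norm (p' - y'))\<^sup>2"
    unfolding p'_def by (rule moreau_eq_prox[OF assms])
  moreover have "moreau h \<mu> y = h p + \<mu> / 2 * (g \<bullet> g)"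
  proof -
    have "p - y = - (\<mu> *\<^sub>R g)" using y by simp
    then show ?thesis
      unfolding moreau_eq_prox[OF assms, of y] p_def[symmetric] power2_norm_eq_inner
      using assms by (simp add: \<open>p - y = _\<close> field_simps)
  qed
  moreover have "1 / (2 * \<mu>) * (norm (p' - y'))\<^sup>2 + g \<bullet> (p' - p) - \<mu> / 2 * (g \<bullet> g) - g \<bullet> (y' - y)
      = 1 / (2 * \<mu>) * (norm (p' - y' + \<mu> *\<^sub>R g))\<^sup>2"
    unfolding power2_norm_eq_inner y using assms
    by (simp add: field_simps inner_simps inner_commute power2_eq_square)
  moreover have "1 / (2 * \<mu>) * (norm (p' - y' + \<mu> *\<^sub>R g))\<^sup>2 \<ge> 0" using assms by simp
  ultimately show ?thesis unfolding g_def p_def by linarith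
qed

lemma GDERIV_moreau:
  assumes "\<mu> > 0"
  shows "GDERIV (moreau h \<mu>) y :> (1 / \<mu>) *\<^sub>R (y - prox h \<mu> y)"
proof (rule GDERIV_of_quadratic_bound)
  fix y'
  have "0 \<le> 1 / (2 * \<mu>) * (norm (y' - y))\<^sup>2" using assms by simp
  then show "\<bar>moreau h \<mu> y' - moreau h \<mu> y - (1 / \<mu>) *\<^sub>R (y - prox h \<mu> y) \<bullet> (y' - y)\<bar>
      \<le> 1 / (2 * \<mu>) * (norm (y' - y))\<^sup>2"
    using moreau_upper[OF assms, of y' y] moreau_lower[OF assms, of y y'] by linarith
qed

lemma moreau_le:
  assumes "\<mu> > 0"
  shows "moreau h \<mu> y \<le> h y"
  using prox_minimal[OF assms, of y y] unfolding moreau_eq_prox[OF assms] by simp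

text \<open>The loss \<open>l r\<close> incurred by moving a distance \<open>r\<close> exceeds the quadratic penalty \<open>r\<^sup>2/(2\<mu>)\<close> by at
  most \<open>\<mu> l\<^sup>2/2\<close>.\<close>

lemma moreau_ge:
  assumes "\<mu> > 0"
  shows "h y - \<mu> * l\<^sup>2 / 2 \<le> moreau h \<mu> y"
proof -
  define r where "r = norm (prox h \<mu> y - y)"
  have "0 \<le> (r - \<mu> * l)\<^sup>2 / (2 * \<mu>)" using assms by simp
  also have "\<dots> = 1 / (2 * \<mu>) * r\<^sup>2 - l * r + \<mu> * l\<^sup>2 / 2"
    using assms by (simp add: field_simps power2_eq_square)
  finally show ?thesis
    unfolding moreau_eq_prox[OF assms] r_def using diff_le[of y "prox h \<mu> y"] by simp
qed

end

section \<open>The composite problem and its augmented Lagrangian\<close>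

locale composite_problem = convex_lipschitz h lh
  for h :: "'b::euclidean_space \<Rightarrow> real" and lh :: real +
  fixes M :: "'a::euclidean_space set" and d :: nat and f :: "'a \<Rightarrow> real" and A :: "'a \<Rightarrow> 'b"
    and R :: "'a \<Rightarrow> 'a \<Rightarrow> 'a" and lf \<alpha> \<beta> :: real
  assumes submanifold: "embedded_submanifold d M" and compact: "compact M"
    and f_diff: "\<And>x. f differentiable (at x)"
    and f_lip: "lf-lipschitz_on UNIV (gradient f)"
    and A: "linear A"
    and retraction: "manifold_retraction M R"
    and \<alpha>: "\<And>x u. x \<in> M \<Longrightarrow> u \<in> tangent_space M x \<Longrightarrow> norm (R x u - x) \<le> \<alpha> * norm u"
    and \<beta>: "\<And>x u. x \<in> M \<Longrightarrow> u \<in> tangent_space M x \<Longrightarrow> norm (R x u - x - u) \<le> \<beta> * (norm u)\<^sup>2"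
    and \<beta>_pos: "\<beta> > 0"
begin

lemma A_bounded: "bounded_linear A"
  using A by (simp add: linear_conv_bounded_linear)

lemma lf_nonneg: "0 \<le> lf" using f_lip by (rule lipschitz_on_nonneg)

lemma subspace_tangent: "x \<in> M \<Longrightarrow> subspace (tangent_space M x)"
  using subspace_tangent_space[OF submanifold] .

lemma retraction_in_M: "x \<in> M \<Longrightarrow> u \<in> tangent_space M x \<Longrightarrow> R x u \<in> M"
  using retraction unfolding manifold_retraction_def by blast

lemma rgrad_in_tangent: "x \<in> M \<Longrightarrow> rgrad M \<psi> x \<in> tangent_space M x"
  unfolding rgrad_def by (rule orth_proj(1)[OF subspace_tangent])

abbreviation (input) al :: "real \<Rightarrow> 'b \<Rightarrow> 'a \<Rightarrow> real" where
  "al \<sigma> z x \<equiv> aug_lagrangian f h A \<sigma> x z"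

text \<open>The third component of the candidate KKT point that belongs to the primal point \<open>x\<close>.\<close>

definition multiplier :: "real \<Rightarrow> 'b \<Rightarrow> 'a \<Rightarrow> 'b" where
  "multiplier \<sigma> z x = z - \<sigma> *\<^sub>R (A x - prox h (1 / \<sigma>) (A x - (1 / \<sigma>) *\<^sub>R z))"

lemma uminus_multiplier:
  assumes "\<sigma> > 0"
  shows "- multiplier \<sigma> z x =
    (1 / (1 / \<sigma>)) *\<^sub>R (A x - (1 / \<sigma>) *\<^sub>R z - prox h (1 / \<sigma>) (A x - (1 / \<sigma>) *\<^sub>R z))"
  using assms unfolding multiplier_def by (simp add: scaleR_diff_right)

lemma multiplier_in_subdifferential:
  assumes "\<sigma> > 0"
  shows "- multiplier \<sigma> z x \<in> subdifferential h (prox h (1 / \<sigma>) (A x - (1 / \<sigma>) *\<^sub>R z))"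
  unfolding uminus_multiplier[OF assms] by (rule prox_subgradient) (use assms in simp)

lemma GDERIV_aug_lagrangian:
  assumes "\<sigma> > 0"
  shows "GDERIV (al \<sigma> z) x :> gradient f x - adjoint A (multiplier \<sigma> z x)"
proof -
  let ?a = "\<lambda>x. A x - (1 / \<sigma>) *\<^sub>R z"
  have "(?a has_derivative A) (at x)"
    using has_derivative_diff[OF bounded_linear_imp_has_derivative[OF A_bounded] has_derivative_const]
    by simp
  moreover have "(moreau h (1 / \<sigma>) has_derivative (\<lambda>w. w \<bullet> (- multiplier \<sigma> z x))) (at (?a x))"
    using GDERIV_moreau[of "1 / \<sigma>" "?a x"] assms
    unfolding gderiv_def uminus_multiplier[OF assms] by simp
  ultimately have "((\<lambda>x. moreau h (1 / \<sigma>) (?a x)) has_derivative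
      (\<lambda>v. A v \<bullet> (- multiplier \<sigma> z x))) (at x)"
    by (rule has_derivative_compose)
  then have "((\<lambda>x. f x + moreau h (1 / \<sigma>) (?a x) - 1 / (2 * \<sigma>) * (norm z)\<^sup>2) has_derivative
      (\<lambda>v. v \<bullet> gradient f x + A v \<bullet> (- multiplier \<sigma> z x) - 0)) (at x)"
    by (intro has_derivative_add has_derivative_diff has_derivative_const)
       (use GDERIV_gradient[OF f_diff] in \<open>auto simp: gderiv_def\<close>)
  then show ?thesis
    unfolding gderiv_def aug_lagrangian_def
    by (simp add: inner_diff_right adjoint_works[OF A])
qed

lemmas gradient_aug_lagrangian = gradient_eq[OF GDERIV_aug_lagrangian]

lemma aug_lagrangian_upper_bound:
  assumes "\<sigma> > 0"
  shows "al \<sigma> z x' \<le> al \<sigma> z x + gradient (al \<sigma> z) x \<bullet> (x' - x)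
           + (lf + \<sigma> * (onorm A)\<^sup>2) / 2 * (norm (x' - x))\<^sup>2"
proof -
  let ?a = "\<lambda>x. A x - (1 / \<sigma>) *\<^sub>R z"
  have Ad: "?a x' - ?a x = A (x' - x)" by (simp add: linear_diff[OF A])
  have "moreau h (1 / \<sigma>) (?a x') \<le> moreau h (1 / \<sigma>) (?a x) + (- multiplier \<sigma> z x) \<bullet> A (x' - x)
      + \<sigma> / 2 * (norm (A (x' - x)))\<^sup>2"
    using moreau_upper[of "1 / \<sigma>" "?a x'" "?a x"] assms
    unfolding uminus_multiplier[OF assms] Ad by simp
  also have "\<dots> \<le> moreau h (1 / \<sigma>) (?a x) + (- multiplier \<sigma> z x) \<bullet> A (x' - x)
      + \<sigma> / 2 * (onorm A * norm (x' - x))\<^sup>2"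
    using onorm[OF A_bounded] assms
    by (intro add_left_mono mult_left_mono power_mono) auto
  also have "(- multiplier \<sigma> z x) \<bullet> A (x' - x) = - (adjoint A (multiplier \<sigma> z x) \<bullet> (x' - x))"
    by (simp add: adjoint_clauses(2)[OF A])
  finally have "moreau h (1 / \<sigma>) (?a x') \<le> moreau h (1 / \<sigma>) (?a x)
      - adjoint A (multiplier \<sigma> z x) \<bullet> (x' - x) + \<sigma> / 2 * (onorm A * norm (x' - x))\<^sup>2"
    by simp
  with lipschitz_gradient_upper_bound[OF f_diff f_lip, of x' x]
  show ?thesis
    unfolding gradient_aug_lagrangian[OF assms] unfolding aug_lagrangian_def
    by (simp add: inner_diff_left algebra_simps power_mult_distrib add_divide_distrib)
qed

text \<open>The dual condition holds with distance \<open>0\<close>, and the primal stationarity residual is the Riemannian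
  gradient of the augmented Lagrangian, so only two inequalities have to be supplied.\<close>

lemma KKT_of_stationary:
  assumes "\<sigma> > 0" "x \<in> M" "norm (rgrad M (al \<sigma> z) x) \<le> \<epsilon>"
    and "y = prox h (1 / \<sigma>) (A x - (1 / \<sigma>) *\<^sub>R z)" "norm (A x - y) \<le> \<epsilon>"
  shows "eps_KKT M f h A \<epsilon> x y (z - \<sigma> *\<^sub>R (A x - y))"
proof -
  have z: "z - \<sigma> *\<^sub>R (A x - y) = multiplier \<sigma> z x"
    unfolding multiplier_def assms(4) ..
  have sub: "- multiplier \<sigma> z x \<in> subdifferential h y"
    unfolding assms(4) by (rule multiplier_in_subdifferential[OF assms(1)])
  have "0 \<le> \<epsilon>" using assms(5) norm_ge_zero order_trans by blast
  then show ?thesis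
    unfolding eps_KKT_def z
    using assms(2,3,5) sub gradient_aug_lagrangian[OF assms(1)]
    by (auto simp: rgrad_def)
qed

section \<open>Riemannian gradient descent\<close>

text \<open>The step \<open>u\<close> is tangent, so \<open>\<nabla>\<psi>\<close> may be replaced by its projection in the linear term. The
  retraction costs a second-order error \<open>G \<beta> \<parallel>u\<parallel>\<^sup>2\<close> there and stretches the quadratic term by \<open>\<alpha>\<^sup>2\<close>.
  Both costs are collected in \<open>L\<close>, and the step length \<open>1/L\<close> minimizes the resulting parabola.\<close>

lemma rgd_step_descent:
  assumes quad: "\<And>x'. \<psi> x' \<le> \<psi> x + gradient \<psi> x \<bullet> (x' - x) + \<kappa> / 2 * (norm (x' - x))\<^sup>2"
    and G: "norm (gradient \<psi> x) \<le> G" and L: "L = \<alpha>\<^sup>2 * \<kappa> + 2 * G * \<beta>" "L > 0"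
    and "0 \<le> \<kappa>" and x: "x \<in> M"
  shows "(norm (rgrad M \<psi> x))\<^sup>2 \<le> 2 * L * (\<psi> x - \<psi> (R x (- ((1 / L) *\<^sub>R rgrad M \<psi> x))))"
proof -
  define g where "g = rgrad M \<psi> x"
  define u where "u = - ((1 / L) *\<^sub>R g)"
  define x' where "x' = R x u"
  have T: "subspace (tangent_space M x)" by (rule subspace_tangent[OF x])
  have u: "u \<in> tangent_space M x"
    unfolding u_def g_def using rgrad_in_tangent[OF x] T by (simp add: subspace_neg subspace_mul)
  have "(gradient \<psi> x - g) \<bullet> u = 0"
    unfolding g_def rgrad_def by (rule orth_proj(2)[OF T u])
  then have "gradient \<psi> x \<bullet> (x' - x) = g \<bullet> u + gradient \<psi> x \<bullet> (x' - x - u)"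
    by (simp add: inner_diff_left inner_diff_right)
  also have "gradient \<psi> x \<bullet> (x' - x - u) \<le> norm (gradient \<psi> x) * norm (x' - x - u)"
    by (rule norm_cauchy_schwarz)
  also have "\<dots> \<le> G * (\<beta> * (norm u)\<^sup>2)"
    unfolding x'_def using G order_trans[OF norm_ge_zero G] \<beta>[OF x u]
    by (intro mult_mono) auto
  finally have lin: "gradient \<psi> x \<bullet> (x' - x) \<le> g \<bullet> u + G * (\<beta> * (norm u)\<^sup>2)" by simp
  have "(norm (x' - x))\<^sup>2 \<le> (\<alpha> * norm u)\<^sup>2"
    unfolding x'_def using \<alpha>[OF x u] by (intro power_mono) auto
  then have "\<kappa> / 2 * (norm (x' - x))\<^sup>2 \<le> \<kappa> / 2 * (\<alpha> * norm u)\<^sup>2"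
    using \<open>0 \<le> \<kappa>\<close> by (intro mult_left_mono) auto
  with quad[of x'] lin
  have "\<psi> x' \<le> \<psi> x + g \<bullet> u + G * (\<beta> * (norm u)\<^sup>2) + \<kappa> / 2 * (\<alpha> * norm u)\<^sup>2" by linarith
  also have "\<dots> = \<psi> x + g \<bullet> u + L / 2 * (norm u)\<^sup>2"
    unfolding L(1) by (simp add: power_mult_distrib field_simps)
  also have "g \<bullet> u = - ((norm g)\<^sup>2 / L)"
    unfolding u_def by (simp add: power2_norm_eq_inner)
  also have "(norm u)\<^sup>2 = (norm g)\<^sup>2 / L\<^sup>2"
    unfolding u_def by (simp add: power_divide)
  finally have "(norm g)\<^sup>2 / (2 * L) \<le> \<psi> x - \<psi> x'"
    using L(2) by (simp add: field_simps power2_eq_square)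
  then show ?thesis
    unfolding g_def[symmetric] u_def[symmetric] x'_def[symmetric]
    using L(2) by (simp add: field_simps)
qed

lemma rgd_iter_in_M:
  assumes "x0 \<in> M"
  shows "rgd_iter M R \<psi> L x0 t \<in> M"
proof (induction t)
  case (Suc t)
  then show ?case
    using retraction_in_M[OF Suc] rgrad_in_tangent[OF Suc] subspace_tangent[OF Suc]
    by (simp add: Let_def subspace_neg subspace_mul)
qed (use assms in simp)

lemma rgd_outputs_in_M:
  assumes "x0 \<in> M" "x \<in> rgd_outputs M R \<psi> L T x0"
  shows "x \<in> M"
  using assms rgd_iter_in_M unfolding rgd_outputs_def by auto

text \<open>Sum the descent inequality over the steps and bound each gradient norm below by the smallest one.
  Since \<open>L = 0\<close> forces \<open>G = 0\<close>, all gradients vanish in that degenerate case.\<close>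

lemma rgd_rate:
  assumes quad: "\<And>x x'. x \<in> M \<Longrightarrow>
      \<psi> x' \<le> \<psi> x + gradient \<psi> x \<bullet> (x' - x) + \<kappa> / 2 * (norm (x' - x))\<^sup>2"
    and G: "\<And>x. x \<in> M \<Longrightarrow> norm (gradient \<psi> x) \<le> G" and L: "L = \<alpha>\<^sup>2 * \<kappa> + 2 * G * \<beta>"
    and "0 \<le> \<kappa>" and x0: "x0 \<in> M" and bdd: "bdd_below (\<psi> ` M)"
    and out: "x \<in> rgd_outputs M R \<psi> L T x0"
  shows "(real T + 1) * (norm (rgrad M \<psi> x))\<^sup>2 \<le> 2 * L * (\<psi> x0 - (INF w\<in>M. \<psi> w))"
proof -
  let ?x = "rgd_iter M R \<psi> L x0"
  have xM: "?x t \<in> M" for t by (rule rgd_iter_in_M[OF x0])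
  have G0: "0 \<le> G" using G[OF x0] norm_ge_zero order_trans by blast
  have inf_le: "(INF w\<in>M. \<psi> w) \<le> \<psi> (?x t)" for t
    by (rule cINF_lower[OF bdd xM])
  have L0: "0 \<le> L" unfolding L using G0 \<open>0 \<le> \<kappa>\<close> \<beta>_pos by simp
  have step: "(norm (rgrad M \<psi> (?x t)))\<^sup>2 \<le> 2 * L * (\<psi> (?x t) - \<psi> (?x (Suc t)))" for t
  proof (cases "L = 0")
    case True
    have "0 \<le> \<alpha>\<^sup>2 * \<kappa>" "0 \<le> 2 * G * \<beta>" using \<open>0 \<le> \<kappa>\<close> G0 \<beta>_pos by simp_all
    then have "2 * G * \<beta> = 0" using True L by linarith
    then have "G = 0" using \<beta>_pos by simp
    then have "norm (rgrad M \<psi> (?x t)) \<le> 0"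
      using norm_orth_proj_le[OF subspace_tangent[OF xM]] G[OF xM[of t]]
      unfolding rgrad_def by (metis order_trans)
    then show ?thesis using True by simp
  next
    case False
    then show ?thesis
      using rgd_step_descent[OF quad[OF xM] G[OF xM] L _ \<open>0 \<le> \<kappa>\<close> xM, of t] L0
      by (simp add: Let_def)
  qed
  obtain t where t: "x = ?x t" "is_arg_min (\<lambda>s. norm (rgrad M \<psi> (?x s))) (\<lambda>s. s \<le> T) t"
    using out unfolding rgd_outputs_def by blast
  then have best: "norm (rgrad M \<psi> x) \<le> norm (rgrad M \<psi> (?x s))" if "s \<le> T" for s
    using that by (simp add: is_arg_min_linorder)
  have "(real T + 1) * (norm (rgrad M \<psi> x))\<^sup>2 = (\<Sum>s<Suc T. (norm (rgrad M \<psi> x))\<^sup>2)" by simp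
  also have "\<dots> \<le> (\<Sum>s<Suc T. 2 * L * (\<psi> (?x s) - \<psi> (?x (Suc s))))"
    by (intro sum_mono order_trans[OF _ step] power_mono best) auto
  also have "\<dots> = 2 * L * (\<psi> x0 - \<psi> (?x (Suc T)))"
    using sum_lessThan_telescope'[of "\<lambda>s. \<psi> (?x s)" "Suc T"]
    by (simp only: sum_distrib_left[symmetric] rgd_iter.simps(1))
  also have "\<dots> \<le> 2 * L * (\<psi> x0 - (INF w\<in>M. \<psi> w))"
    using L0 inf_le[of "Suc T"] by (intro mult_left_mono) auto
  finally show ?thesis .
qed

end

section \<open>Runs of the algorithm\<close>

text \<open>The numerator \<open>\<parallel>A x\<^sup>0 - y\<^sup>0\<parallel>\<close> of the step size rule is \<open>0\<close>. So the dual step size is \<open>0\<close> unless the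
  residual itself is \<open>0\<close>, and in either case the multiplier does not move.\<close>

lemma manial_dual_zero:
  assumes "manial_run M f h A R x0 \<beta>0 \<sigma> L T x y z s"
  shows "z k = 0"
proof (induction k)
  case 0
  then show ?case using assms unfolding manial_run_def by simp
next
  case (Suc k)
  have "norm (A (x 0) - y 0) = 0" using assms unfolding manial_run_def by simp
  with assms have "s (Suc k) *\<^sub>R (A (x (Suc k)) - y (Suc k)) = 0"
    unfolding manial_run_def Let_def by (auto split: if_splits)
  moreover have "z (Suc k) = z k - s (Suc k) *\<^sub>R (A (x (Suc k)) - y (Suc k))"
    using assms unfolding manial_run_def Let_def by blast
  ultimately show ?case using Suc by simp
qed

lemma manial_run_step:
  assumes "manial_run M f h A R x0 \<beta>0 \<sigma> L T x y z s"
  shows "x (Suc k) \<in> rgd_outputs M R (\<lambda>w. aug_lagrangian f h A (\<sigma> k) w (z k)) (L k)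
           (T k (\<lambda>w. aug_lagrangian f h A (\<sigma> k) w (z k)) (x k)) (x k)"
    and "y (Suc k) = prox h (1 / \<sigma> k) (A (x (Suc k)) - (1 / \<sigma> k) *\<^sub>R z k)"
  using assms unfolding manial_run_def Let_def by blast+

section \<open>Counting oracle calls\<close>

lemma geometric_sum_le_last:
  fixes q :: real
  assumes "q > 1"
  shows "(\<Sum>k\<le>K. q ^ k) \<le> q / (q - 1) * q ^ K"
proof -
  have "(\<Sum>k\<le>K. q ^ k) = (q ^ Suc K - 1) / (q - 1)"
    using geometric_sum[of q "Suc K"] assms by (simp add: lessThan_Suc_atMost)
  also have "\<dots> \<le> q ^ Suc K / (q - 1)"
    using assms by (intro divide_right_mono) auto
  finally show ?thesis by simp
qed

text \<open>Take the first power of \<open>b\<close> that reaches \<open>r\<close>; the previous one is below \<open>r\<close>. The summand \<open>1\<close> covers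
  the case that already \<open>b\<^sup>0\<close> suffices.\<close>

lemma ex_power_within_factor:
  fixes b r :: real
  assumes "b > 1" "r > 0"
  obtains K where "r \<le> b ^ K" "b ^ K \<le> 1 + b * r"
proof -
  define K where "K = (LEAST K. r \<le> b ^ K)"
  obtain n where "r < b ^ n" using real_arch_pow[OF assms(1)] by blast
  then have K: "r \<le> b ^ K" unfolding K_def by (metis LeastI less_imp_le)
  moreover have "b ^ K \<le> 1 + b * r"
  proof (cases K)
    case 0
    then show ?thesis using assms by simp
  next
    case (Suc n)
    have "\<not> r \<le> b ^ n" using not_less_Least[of n "\<lambda>K. r \<le> b ^ K"] Suc unfolding K_def by simp
    then show ?thesis unfolding Suc using assms by (simp add: add_increasing)
  qed
  ultimately show ?thesis by (rule that)
qed

text \<open>Bound on the number of oracle calls when iteration \<open>k\<close> costs at most \<open>C b\<^bsup>3k\<^esup>\<close> and yields a KKT point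
  with tolerance \<open>c/b\<^sup>k\<close>: the middle factor sums the geometric series, and the last one bounds the
  cubed penalty at the first sufficient iteration.\<close>

definition call_bound :: "real \<Rightarrow> real \<Rightarrow> real \<Rightarrow> real \<Rightarrow> real" where
  "call_bound b c C \<epsilon> = C * (b ^ 3 / (b ^ 3 - 1)) * (1 + b * c / \<epsilon>) ^ 3"

lemma call_bound_bigo:
  assumes "b > 1" "c > 0" "C \<ge> 0"
  shows "call_bound b c C \<in> O[at_right 0](\<lambda>\<epsilon>. 1 / \<epsilon> ^ 3)"
proof (rule bigoI)
  define B where "B = C * (b ^ 3 / (b ^ 3 - 1))"
  have B: "0 \<le> B" unfolding B_def using assms one_less_power[of b 3] by simp
  have "norm (call_bound b c C \<epsilon>) \<le> B * (1 + b * c) ^ 3 * norm (1 / \<epsilon> ^ 3)"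
    if "\<epsilon> \<in> {0<..<1}" for \<epsilon>
  proof -
    have pos: "0 \<le> 1 + b * c / \<epsilon>" using that assms by simp
    have "1 + b * c / \<epsilon> \<le> (1 + b * c) / \<epsilon>" using that by (simp add: field_simps)
    then have "(1 + b * c / \<epsilon>) ^ 3 \<le> (1 + b * c) ^ 3 * (1 / \<epsilon> ^ 3)"
      using power_mono[OF _ pos, of "(1 + b * c) / \<epsilon>" 3] by (simp add: power_divide)
    then have "B * (1 + b * c / \<epsilon>) ^ 3 \<le> B * ((1 + b * c) ^ 3 * (1 / \<epsilon> ^ 3))"
      using B by (rule mult_left_mono)
    moreover have "norm (call_bound b c C \<epsilon>) = B * (1 + b * c / \<epsilon>) ^ 3"
      unfolding call_bound_def B_def[symmetric] using B pos by simp
    ultimately show ?thesis using that by (simp add: mult.assoc)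
  qed
  then show "eventually (\<lambda>\<epsilon>. norm (call_bound b c C \<epsilon>) \<le> B * (1 + b * c) ^ 3 * norm (1 / \<epsilon> ^ 3)) (at_right 0)"
    by - (rule eventually_mono[OF eventually_at_right_real[of 0 1]], auto)
qed

context composite_problem
begin

text \<open>The objective \<open>f + h \<circ> A\<close> is bounded on the compact set \<open>M\<close>, and passing to the Moreau envelope
  lowers it by at most \<open>l\<^sub>h\<^sup>2/(2\<sigma>)\<close>. A bound that does not depend on \<open>\<sigma>\<close> or on the run is needed to
  choose the complexity function before the run is known.\<close>

lemma aug_lagrangian_gap:
  obtains D where "D \<ge> 0"
    "\<And>\<sigma> u. \<sigma> \<ge> 1 \<Longrightarrow> u \<in> M \<Longrightarrow> al \<sigma> 0 u - (INF w\<in>M. al \<sigma> 0 w) \<le> D"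
    "\<And>\<sigma>. \<sigma> \<ge> 1 \<Longrightarrow> bdd_below (al \<sigma> 0 ` M)"
proof -
  have "continuous_on M f"
    using f_diff by (meson continuous_at_imp_continuous_on differentiable_imp_continuous_within)
  moreover have "continuous_on M (\<lambda>x. h (A x))"
    by (rule continuous_on_compose2[OF continuous[of UNIV] linear_continuous_on[OF A_bounded]]) simp
  ultimately have "compact ((\<lambda>x. f x + h (A x)) ` M)"
    by (intro compact_continuous_image compact continuous_intros)
  then obtain B where "\<forall>x\<in>M. norm (f x + h (A x)) \<le> B"
    by (auto dest!: compact_imp_bounded simp: bounded_iff)
  then have B: "\<And>x. x \<in> M \<Longrightarrow> \<bar>f x + h (A x)\<bar> \<le> B" by simp
  define D where "D = \<bar>2 * B\<bar> + lh\<^sup>2 / 2"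
  have upper: "al \<sigma> 0 x \<le> B" if "\<sigma> \<ge> 1" "x \<in> M" for \<sigma> x
    using moreau_le[of "1 / \<sigma>" "A x"] B[OF that(2)] that(1) unfolding aug_lagrangian_def by simp
  have lower: "- B - lh\<^sup>2 / 2 \<le> al \<sigma> 0 x" if "\<sigma> \<ge> 1" "x \<in> M" for \<sigma> x
  proof -
    have "1 / \<sigma> * lh\<^sup>2 / 2 \<le> lh\<^sup>2 / 2"
      using that(1) by (simp add: divide_le_eq mult_le_cancel_left1)
    then show ?thesis
      using moreau_ge[of "1 / \<sigma>" "A x"] B[OF that(2)] that(1) unfolding aug_lagrangian_def by simp
  qed
  show ?thesis
  proof (rule that)
    show "0 \<le> D" unfolding D_def by simp
    fix \<sigma> :: real assume \<sigma>: "\<sigma> \<ge> 1"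
    show "bdd_below (al \<sigma> 0 ` M)" using lower[OF \<sigma>] by (rule bdd_belowI2)
    fix u assume u: "u \<in> M"
    have "- B - lh\<^sup>2 / 2 \<le> (INF w\<in>M. al \<sigma> 0 w)"
      using u lower[OF \<sigma>] by (intro cINF_greatest) auto
    then show "al \<sigma> 0 u - (INF w\<in>M. al \<sigma> 0 w) \<le> D"
      using upper[OF \<sigma> u] unfolding D_def by linarith
  qed
qed

lemma rgd_const_le:
  assumes "\<sigma> \<ge> 1" "0 \<le> G"
  shows "0 \<le> rgd_const A \<alpha> \<beta> lf G \<sigma>" "rgd_const A \<alpha> \<beta> lf G \<sigma> \<le> rgd_const A \<alpha> \<beta> lf G 1 * \<sigma>"
proof -
  show "0 \<le> rgd_const A \<alpha> \<beta> lf G \<sigma>"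
    unfolding rgd_const_def using assms lf_nonneg \<beta>_pos by simp
  have "0 \<le> (\<alpha>\<^sup>2 * lf + 2 * G * \<beta>) * (\<sigma> - 1)"
    using assms lf_nonneg \<beta>_pos by simp
  then show "rgd_const A \<alpha> \<beta> lf G \<sigma> \<le> rgd_const A \<alpha> \<beta> lf G 1 * \<sigma>"
    unfolding rgd_const_def by (simp add: algebra_simps)
qed

lemma manial_iterates_in_M:
  assumes "manial_run M f h A R x0 \<beta>0 \<sigma> L T x y z s" "x0 \<in> M"
  shows "x k \<in> M"
proof (induction k)
  case 0
  then show ?case using assms unfolding manial_run_def by simp
next
  case (Suc k)
  then show ?case using rgd_outputs_in_M manial_run_step(1)[OF assms(1)] by blast
qed

lemma manial_inner_rate:
  assumes run: "manial_run M f h A R x0 \<beta>0 \<sigma> (\<lambda>k. rgd_const A \<alpha> \<beta> lf G (\<sigma> k)) T x y z s"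
    and x0: "x0 \<in> M"
    and G: "\<forall>w\<in>M. norm (gradient (al (\<sigma> k) (z k)) w) \<le> G"
    and \<sigma>: "\<sigma> k \<ge> 1"
    and bdd: "bdd_below (al (\<sigma> k) 0 ` M)"
  shows "(real (T k (al (\<sigma> k) (z k)) (x k)) + 1) * (norm (rgrad M (al (\<sigma> k) (z k)) (x (Suc k))))\<^sup>2
      \<le> 2 * rgd_const A \<alpha> \<beta> lf G (\<sigma> k)
          * (al (\<sigma> k) (z k) (x k) - (INF w\<in>M. al (\<sigma> k) (z k) w))"
proof (rule rgd_rate)
  show "al (\<sigma> k) (z k) u' \<le> al (\<sigma> k) (z k) u + gradient (al (\<sigma> k) (z k)) u \<bullet> (u' - u)
      + (lf + \<sigma> k * (onorm A)\<^sup>2) / 2 * (norm (u' - u))\<^sup>2" for u u'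
    using \<sigma> by (intro aug_lagrangian_upper_bound) auto
  show "norm (gradient (al (\<sigma> k) (z k)) u) \<le> G" if "u \<in> M" for u using G that by blast
  show "0 \<le> lf + \<sigma> k * (onorm A)\<^sup>2" using lf_nonneg \<sigma> by simp
  show "bdd_below (al (\<sigma> k) (z k) ` M)" using bdd unfolding manial_dual_zero[OF run] .
qed (use manial_run_step(1)[OF run] manial_iterates_in_M[OF run x0] in \<open>auto simp: rgd_const_def\<close>)

text \<open>Common core of the two options. The residual \<open>\<parallel>A x - y\<parallel>\<close> is at most \<open>l\<^sub>h/b\<^sup>k\<close>, because \<open>b\<^sup>k (A x - y)\<close> is
  a subgradient of \<open>h\<close> when the multiplier is \<open>0\<close>. So iteration \<open>K\<close> succeeds as soon as
  \<open>c/b\<^sup>K \<le> \<epsilon>\<close>, and the cost up to the first such \<open>K\<close> is a geometric sum.\<close>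

lemma manial_complexity:
  assumes run: "manial_run M f h A R x0 \<beta>0 (\<lambda>k. b ^ k) L T x y z s"
    and x0: "x0 \<in> M" and b: "b > 1" and c: "c > 0" "lh \<le> c"
    and stationary: "\<And>k. norm (rgrad M (al (b ^ k) (z k)) (x (Suc k))) \<le> c / b ^ k"
    and budget: "\<And>k. real (T k (al (b ^ k) (z k)) (x k)) + 2 \<le> C * (b ^ k) ^ 3"
    and \<epsilon>: "\<epsilon> > 0"
  shows "\<exists>K. KKT_found_at M f h A (\<lambda>k. b ^ k) \<epsilon> x y z K \<and>
             real (oracle_calls f h A (\<lambda>k. b ^ k) T x z K) \<le> call_bound b c C \<epsilon>"
proof -
  obtain K where K: "c / \<epsilon> \<le> b ^ K" "b ^ K \<le> 1 + b * (c / \<epsilon>)"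
    using ex_power_within_factor[OF b] c(1) \<epsilon> by (metis divide_pos_pos)
  have bK: "b ^ k > 0" for k using b by simp
  have c_le: "c / b ^ K \<le> \<epsilon>" using K(1) \<epsilon> bK[of K] by (simp add: field_simps)
  have z: "z k = 0" for k by (rule manial_dual_zero[OF run])
  have y: "y (Suc K) = prox h (1 / b ^ K) (A (x (Suc K)) - (1 / b ^ K) *\<^sub>R z K)"
    using manial_run_step(2)[OF run] .
  have "norm (A (x (Suc K)) - y (Suc K)) \<le> c / b ^ K"
  proof -
    have "norm (multiplier (b ^ K) (z K) (x (Suc K))) \<le> lh"
      using norm_subgradient_le[OF multiplier_in_subdifferential[OF bK]] by simp
    then have "b ^ K * norm (A (x (Suc K)) - y (Suc K)) \<le> lh"
      unfolding multiplier_def y using b by (simp add: z)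
    then show ?thesis using c(2) bK[of K] by (simp add: field_simps)
  qed
  then have "KKT_found_at M f h A (\<lambda>k. b ^ k) \<epsilon> x y z K"
    unfolding KKT_found_at_def using c_le stationary[of K]
    by (intro KKT_of_stationary[OF bK manial_iterates_in_M[OF run x0] _ y]) linarith+
  moreover have "real (oracle_calls f h A (\<lambda>k. b ^ k) T x z K) \<le> call_bound b c C \<epsilon>"
  proof -
    have q: "b ^ 3 > 1" using b by (simp add: one_less_power)
    have C: "C \<ge> 0"
      using budget[of 0] by simp
    have "real (oracle_calls f h A (\<lambda>k. b ^ k) T x z K)
        = (\<Sum>k\<le>K. real (T k (al (b ^ k) (z k)) (x k)) + 2)"
      unfolding oracle_calls_def by (simp add: algebra_simps)
    also have "\<dots> \<le> (\<Sum>k\<le>K. C * (b ^ k) ^ 3)" by (intro sum_mono budget)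
    also have "\<dots> = C * (\<Sum>k\<le>K. (b ^ 3) ^ k)"
      by (simp add: sum_distrib_left mult.commute flip: power_mult)
    also have "\<dots> \<le> C * (b ^ 3 / (b ^ 3 - 1) * (b ^ 3) ^ K)"
      by (intro mult_left_mono geometric_sum_le_last q C)
    also have "(b ^ 3) ^ K = (b ^ K) ^ 3" by (simp add: mult.commute flip: power_mult)
    also have "C * (b ^ 3 / (b ^ 3 - 1) * (b ^ K) ^ 3) \<le> call_bound b c C \<epsilon>"
      unfolding call_bound_def mult.assoc
      using K(2) bK[of K] q C b by (intro mult_left_mono power_mono divide_nonneg_nonneg) auto
    finally show ?thesis .
  qed
  ultimately show ?thesis by blast
qed

end

theorem theorem3p9:
  fixes M :: "(real ^ 'n) set" and d :: nat
    and f :: "real ^ 'n \<Rightarrow> real" and h :: "real ^ 'm \<Rightarrow> real" and A :: "real ^ 'n \<Rightarrow> real ^ 'm"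
    and R :: "real ^ 'n \<Rightarrow> real ^ 'n \<Rightarrow> real ^ 'n" and x0 :: "real ^ 'n"
    and l\<^sub>f l\<^sub>h \<alpha> \<beta> \<beta>0 G :: real
  assumes manifold: "embedded_submanifold d M" "compact M"
    and f: "\<forall>x. f differentiable (at x)" "continuous_on UNIV (gradient f)"
           "l\<^sub>f-lipschitz_on UNIV (gradient f)"
    and A: "linear A"
    and h: "convex_on UNIV h" "l\<^sub>h-lipschitz_on UNIV h"
    and bounded_below: "bdd_below ((\<lambda>x. f x + h (A x)) ` M)"
    and retr: "manifold_retraction M R" "\<alpha> > 0" "\<beta> > 0"
      "\<forall>x\<in>M. \<forall>u\<in>tangent_space M x. norm (R x u - x) \<le> \<alpha> * norm u"
      "\<forall>x\<in>M. \<forall>u\<in>tangent_space M x. norm (R x u - x - u) \<le> \<beta> * (norm u)\<^sup>2"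
    and input: "x0 \<in> M" "\<beta>0 > 0"
  shows "(\<forall>b>1. let \<sigma> = (\<lambda>k. b ^ k); eps = (\<lambda>k. 1 / \<sigma> k);
                L = (\<lambda>k. rgd_const A \<alpha> \<beta> l\<^sub>f G (\<sigma> k)); T = budget_I M L eps in
           \<exists>N :: real \<Rightarrow> real. soft_bigo N (\<lambda>\<epsilon>. 1 / \<epsilon> ^ 3) \<and>
             (\<forall>x y z s. manial_run M f h A R x0 \<beta>0 \<sigma> L T x y z s \<longrightarrow>
                (\<forall>k. \<forall>w\<in>M. norm (gradient (\<lambda>v. aug_lagrangian f h A (\<sigma> k) v (z k)) w) \<le> G) \<longrightarrow>
                (\<forall>k. norm (rgrad M (\<lambda>v. aug_lagrangian f h A (\<sigma> k) v (z k)) (x (Suc k))) \<le> eps k) \<and>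
                (\<forall>\<epsilon>>0. \<exists>K. KKT_found_at M f h A \<sigma> \<epsilon> x y z K \<and>
                            real (oracle_calls f h A \<sigma> T x z K) \<le> N \<epsilon>))) \<and>
         (let \<sigma> = (\<lambda>k. 2 powr (real k / 3));
                L = (\<lambda>k. rgd_const A \<alpha> \<beta> l\<^sub>f G (\<sigma> k)); T = budget_II in
           \<exists>N :: real \<Rightarrow> real. N \<in> O[at_right 0](\<lambda>\<epsilon>. 1 / \<epsilon> ^ 3) \<and>
             (\<forall>x y z s. manial_run M f h A R x0 \<beta>0 \<sigma> L T x y z s \<longrightarrow>
                (\<forall>k. \<forall>w\<in>M. norm (gradient (\<lambda>v. aug_lagrangian f h A (\<sigma> k) v (z k)) w) \<le> G) \<longrightarrow>
                (\<forall>\<epsilon>>0. \<exists>K. KKT_found_at M f h A \<sigma> \<epsilon> x y z K \<and>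
                            real (oracle_calls f h A \<sigma> T x z K) \<le> N \<epsilon>)))"
proof -
  interpret composite_problem h l\<^sub>h M d f A R l\<^sub>f \<alpha> \<beta>
    using assms by unfold_locales (auto simp: linear_add linear_scale)
  obtain D where D: "D \<ge> 0"
    "\<And>\<sigma> u. \<sigma> \<ge> 1 \<Longrightarrow> u \<in> M \<Longrightarrow>
      aug_lagrangian f h A \<sigma> u 0 - (INF w\<in>M. aug_lagrangian f h A \<sigma> w 0) \<le> D"
    and bdd: "\<And>\<sigma>. \<sigma> \<ge> 1 \<Longrightarrow> bdd_below ((\<lambda>w. aug_lagrangian f h A \<sigma> w 0) ` M)"
    by (rule aug_lagrangian_gap) (rule that; simp)
  \<comment> \<open>The complexity function is chosen before a run is given, and only a run shows that \<open>G\<close> is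
    nonnegative; the absolute value keeps the constant nonnegative in any case.\<close>
  define \<Lambda> where "\<Lambda> = \<bar>rgd_const A \<alpha> \<beta> l\<^sub>f G 1\<bar>"
  have \<Lambda>: "0 \<le> rgd_const A \<alpha> \<beta> l\<^sub>f G \<sigma>" "rgd_const A \<alpha> \<beta> l\<^sub>f G \<sigma> \<le> \<Lambda> * \<sigma>"
    if "0 \<le> G" "\<sigma> \<ge> 1" for \<sigma>
  proof -
    show "0 \<le> rgd_const A \<alpha> \<beta> l\<^sub>f G \<sigma>" using rgd_const_le(1) that by blast
    have "0 \<le> rgd_const A \<alpha> \<beta> l\<^sub>f G 1" by (rule rgd_const_le(1)) (use that in auto)
    then show "rgd_const A \<alpha> \<beta> l\<^sub>f G \<sigma> \<le> \<Lambda> * \<sigma>"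
      using rgd_const_le(2)[OF that(2,1)] unfolding \<Lambda>_def by simp
  qed
  have \<Lambda>0: "0 \<le> \<Lambda>" unfolding \<Lambda>_def by simp
  have G0: "0 \<le> G" if "\<forall>w\<in>M. norm (gradient \<psi> w) \<le> G" for \<psi> :: "real ^ 'n \<Rightarrow> real"
    using that input(1) norm_ge_zero order_trans by blast

  have option_I: "let \<sigma> = (\<lambda>k. b ^ k); eps = (\<lambda>k. 1 / \<sigma> k);
      L = (\<lambda>k. rgd_const A \<alpha> \<beta> l\<^sub>f G (\<sigma> k)); T = budget_I M L eps in
    \<exists>N :: real \<Rightarrow> real. soft_bigo N (\<lambda>\<epsilon>. 1 / \<epsilon> ^ 3) \<and>
      (\<forall>x y z s. manial_run M f h A R x0 \<beta>0 \<sigma> L T x y z s \<longrightarrow>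
        (\<forall>k. \<forall>w\<in>M. norm (gradient (\<lambda>v. aug_lagrangian f h A (\<sigma> k) v (z k)) w) \<le> G) \<longrightarrow>
        (\<forall>k. norm (rgrad M (\<lambda>v. aug_lagrangian f h A (\<sigma> k) v (z k)) (x (Suc k))) \<le> eps k) \<and>
        (\<forall>\<epsilon>>0. \<exists>K. KKT_found_at M f h A \<sigma> \<epsilon> x y z K \<and>
                    real (oracle_calls f h A \<sigma> T x z K) \<le> N \<epsilon>))" if b: "b > 1" for b :: real
  proof -
    define c where "c = max 1 l\<^sub>h"
    \<comment> \<open>The \<open>4\<close> absorbs the rounding in the budget and the two calls per outer iteration beyond it.\<close>
    define C where "C = 2 * \<Lambda> * D + 4"
    show ?thesis
      unfolding Let_def
    proof (intro exI[of _ "call_bound b c C"] conjI allI impI)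
      have "call_bound b c C \<in> O[at_right 0](\<lambda>\<epsilon>. 1 / \<epsilon> ^ 3)"
        by (rule call_bound_bigo) (use b D(1) \<Lambda>0 in \<open>auto simp: c_def C_def\<close>)
      then show "soft_bigo (call_bound b c C) (\<lambda>\<epsilon>. 1 / \<epsilon> ^ 3)"
        unfolding soft_bigo_def by (intro exI[of _ 0]) simp
      fix x y z s
      let ?L = "\<lambda>k. rgd_const A \<alpha> \<beta> l\<^sub>f G (b ^ k)"
      let ?T = "budget_I M ?L (\<lambda>k. 1 / b ^ k)"
      let ?\<psi> = "\<lambda>k w. aug_lagrangian f h A (b ^ k) w (z k)"
      let ?\<Delta> = "\<lambda>k. ?\<psi> k (x k) - (INF w\<in>M. ?\<psi> k w)"
      assume run: "manial_run M f h A R x0 \<beta>0 (\<lambda>k. b ^ k) ?L ?T x y z s"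
        and grad: "\<forall>k. \<forall>w\<in>M. norm (gradient (?\<psi> k) w) \<le> G"
      have z: "z k = 0" for k by (rule manial_dual_zero[OF run])
      have xM: "x k \<in> M" for k by (rule manial_iterates_in_M[OF run input(1)])
      have \<sigma>: "1 \<le> b ^ k" for k using b by simp
      have G: "0 \<le> G" using G0 grad by blast
      have gap: "0 \<le> ?\<Delta> k" "?\<Delta> k \<le> D" for k
        unfolding z using cINF_lower[OF bdd[OF \<sigma>] xM] D(2)[OF \<sigma> xM] by auto
      have rate: "(real (?T k (?\<psi> k) (x k)) + 1) * (norm (rgrad M (?\<psi> k) (x (Suc k))))\<^sup>2 \<le> 2 * ?L k * ?\<Delta> k" for k
        by (rule manial_inner_rate[OF run input(1) _ \<sigma> bdd[OF \<sigma>]]) (use grad in blast)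
      have stationary: "norm (rgrad M (?\<psi> k) (x (Suc k))) \<le> 1 / b ^ k" for k
      proof -
        let ?g = "norm (rgrad M (?\<psi> k) (x (Suc k)))"
        let ?t = "real (?T k (?\<psi> k) (x k)) + 1"
        have "2 * ?L k * ?\<Delta> k / (1 / b ^ k)\<^sup>2 \<le> ?t"
          unfolding budget_I_def by (simp add: of_nat_max) linarith
        then have "2 * ?L k * ?\<Delta> k \<le> ?t * (1 / b ^ k)\<^sup>2"
          using b by (simp add: field_simps)
        with rate[of k] have "?t * ?g\<^sup>2 \<le> ?t * (1 / b ^ k)\<^sup>2" by linarith
        then have "?g\<^sup>2 \<le> (1 / b ^ k)\<^sup>2" by (simp add: mult_le_cancel_left_pos)
        then show ?thesis by (rule power2_le_imp_le) (use b in simp)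
      qed
      then show "norm (rgrad M (?\<psi> k) (x (Suc k))) \<le> 1 / b ^ k" for k .
      have budget: "real (?T k (?\<psi> k) (x k)) + 2 \<le> C * (b ^ k) ^ 3" for k
      proof -
        have "2 * ?L k * ?\<Delta> k \<le> 2 * (\<Lambda> * b ^ k) * D"
          using \<Lambda>[OF G \<sigma>] gap[of k] \<Lambda>0 b by (intro mult_mono) auto
        then have "2 * ?L k * ?\<Delta> k / (1 / b ^ k)\<^sup>2 \<le> 2 * (\<Lambda> * b ^ k) * D / (1 / b ^ k)\<^sup>2"
          by (rule divide_right_mono) simp
        also have "\<dots> = 2 * \<Lambda> * D * (b ^ k) ^ 3"
          by (simp add: power_divide power2_eq_square power3_eq_cube)
        finally have q: "2 * ?L k * ?\<Delta> k / (1 / b ^ k)\<^sup>2 \<le> 2 * \<Lambda> * D * (b ^ k) ^ 3" .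
        have "0 \<le> 2 * ?L k * ?\<Delta> k / (1 / b ^ k)\<^sup>2"
          using \<Lambda>(1)[OF G \<sigma>] gap(1) by simp
        then have "real (?T k (?\<psi> k) (x k)) \<le> 2 * ?L k * ?\<Delta> k / (1 / b ^ k)\<^sup>2 + 2"
          unfolding budget_I_def by (simp add: of_nat_max) linarith
        moreover have "1 \<le> (b ^ k) ^ 3" using \<sigma>[of k] by (rule one_le_power)
        ultimately show ?thesis
          using q unfolding C_def by (simp add: algebra_simps)
      qed
      fix \<epsilon> :: real assume "\<epsilon> > 0"
      show "\<exists>K. KKT_found_at M f h A (\<lambda>k. b ^ k) \<epsilon> x y z K \<and>
          real (oracle_calls f h A (\<lambda>k. b ^ k) ?T x z K) \<le> call_bound b c C \<epsilon>"
      proof (rule manial_complexity[OF run input(1) b _ _ _ budget \<open>\<epsilon> > 0\<close>])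
        show "norm (rgrad M (?\<psi> k) (x (Suc k))) \<le> c / b ^ k" for k
          using stationary[of k] b divide_right_mono[of 1 c "b ^ k"] unfolding c_def by simp
      qed (auto simp: c_def)
    qed
  qed

  have option_II: "let \<sigma> = (\<lambda>k. 2 powr (real k / 3));
      L = (\<lambda>k. rgd_const A \<alpha> \<beta> l\<^sub>f G (\<sigma> k)); T = budget_II in
    \<exists>N :: real \<Rightarrow> real. N \<in> O[at_right 0](\<lambda>\<epsilon>. 1 / \<epsilon> ^ 3) \<and>
      (\<forall>x y z s. manial_run M f h A R x0 \<beta>0 \<sigma> L T x y z s \<longrightarrow>
        (\<forall>k. \<forall>w\<in>M. norm (gradient (\<lambda>v. aug_lagrangian f h A (\<sigma> k) v (z k)) w) \<le> G) \<longrightarrow>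
        (\<forall>\<epsilon>>0. \<exists>K. KKT_found_at M f h A \<sigma> \<epsilon> x y z K \<and>
                    real (oracle_calls f h A \<sigma> T x z K) \<le> N \<epsilon>))"
  proof -
    define b :: real where "b = 2 powr (1 / 3)"
    have b: "b > 1" unfolding b_def by simp
    \<comment> \<open>The penalties of Option II are powers of the cube root of \<open>2\<close>, chosen so that the budget
      \<open>2 ^ k\<close> is the cubed penalty.\<close>
    have \<sigma>_eq: "(\<lambda>k. 2 powr (real k / 3)) = (\<lambda>k. b ^ k)"
      unfolding b_def by (auto simp: powr_powr simp flip: powr_realpow)
    have b3: "b ^ 3 = 2" unfolding b_def by (simp add: powr_powr flip: powr_realpow)
    have cube: "(b ^ k) ^ 3 = 2 ^ k" for k by (simp add: b3 power_mult[symmetric] mult.commute flip: b3)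
    \<comment> \<open>The square root bounds \<open>b ^ k\<close> times the gradient norm that the subroutine reaches.\<close>
    define c where "c = max (max 1 l\<^sub>h) (sqrt (2 * \<Lambda> * D))"
    show ?thesis
      unfolding \<sigma>_eq Let_def
    proof (intro exI[of _ "call_bound b c 3"] conjI allI impI)
      show "call_bound b c 3 \<in> O[at_right 0](\<lambda>\<epsilon>. 1 / \<epsilon> ^ 3)"
        by (rule call_bound_bigo) (use b in \<open>auto simp: c_def\<close>)
      fix x y z s and \<epsilon> :: real
      let ?L = "\<lambda>k. rgd_const A \<alpha> \<beta> l\<^sub>f G (b ^ k)"
      let ?\<psi> = "\<lambda>k w. aug_lagrangian f h A (b ^ k) w (z k)"
      let ?\<Delta> = "\<lambda>k. ?\<psi> k (x k) - (INF w\<in>M. ?\<psi> k w)"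
      assume run: "manial_run M f h A R x0 \<beta>0 (\<lambda>k. b ^ k) ?L budget_II x y z s"
        and grad: "\<forall>k. \<forall>w\<in>M. norm (gradient (?\<psi> k) w) \<le> G" and "\<epsilon> > 0"
      have z: "z k = 0" for k by (rule manial_dual_zero[OF run])
      have xM: "x k \<in> M" for k by (rule manial_iterates_in_M[OF run input(1)])
      have \<sigma>: "1 \<le> b ^ k" for k using b by simp
      have G: "0 \<le> G" using G0 grad by blast
      have gap: "0 \<le> ?\<Delta> k" "?\<Delta> k \<le> D" for k
        unfolding z using cINF_lower[OF bdd[OF \<sigma>] xM] D(2)[OF \<sigma> xM] by auto
      have rate: "(real (budget_II k (?\<psi> k) (x k)) + 1) * (norm (rgrad M (?\<psi> k) (x (Suc k))))\<^sup>2
          \<le> 2 * ?L k * ?\<Delta> k" for k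
        by (rule manial_inner_rate[OF run input(1) _ \<sigma> bdd[OF \<sigma>]]) (use grad in blast)
      show "\<exists>K. KKT_found_at M f h A (\<lambda>k. b ^ k) \<epsilon> x y z K \<and>
          real (oracle_calls f h A (\<lambda>k. b ^ k) budget_II x z K) \<le> call_bound b c 3 \<epsilon>"
      proof (rule manial_complexity[OF run input(1) b _ _ _ _ \<open>\<epsilon> > 0\<close>])
        fix k
        let ?g = "norm (rgrad M (?\<psi> k) (x (Suc k)))"
        have "(b ^ k) ^ 3 * ?g\<^sup>2 \<le> (real (budget_II k (?\<psi> k) (x k)) + 1) * ?g\<^sup>2"
          unfolding cube budget_II_def by (intro mult_right_mono) auto
        also have "\<dots> \<le> 2 * (\<Lambda> * b ^ k) * D"
          using rate[of k] \<Lambda>[OF G \<sigma>] gap[of k] \<Lambda>0 b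
          by (elim order_trans, intro mult_mono) auto
        finally have "b ^ k * ((b ^ k)\<^sup>2 * ?g\<^sup>2) \<le> b ^ k * (2 * \<Lambda> * D)"
          by (simp add: power2_eq_square power3_eq_cube mult_ac)
        then have "(b ^ k * ?g)\<^sup>2 \<le> 2 * \<Lambda> * D"
          using b by (simp add: power_mult_distrib)
        then have "b ^ k * ?g \<le> c"
          unfolding c_def using real_le_rsqrt by (simp add: le_max_iff_disj)
        then show "?g \<le> c / b ^ k" using b by (simp add: field_simps)
        show "real (budget_II k (?\<psi> k) (x k)) + 2 \<le> 3 * (b ^ k) ^ 3"
          unfolding cube budget_II_def by simp
      qed (auto simp: c_def)
    qed
  qed

  show ?thesis using option_I option_II by blast
qed

end
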